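(* The problem \textsc{Vertex Cover above $h$-Index} is fixed-parameter tractable: there is a computable function $f$ and an algorithm that, given a graph $G$ and an integer $k$, decides whether $G$ has a vertex cover of size at most $k$ in time $f(\ell)\cdot |I|^{O(1)}$, where $\ell = k - h(G)$ and $|I|$ is the size of the input.
   Context: All graphs are finite, undirected and loopless. A vertex cover of $G$ is a set $X\subseteq V(G)$ such that every edge has at least one endpoint in $X$. The $h$-index $h(G)$ of a graph $G$ is the largest integer $k$ such that $G$ contains at least $k$ vertices each of degree at least $k$. A parameterized problem is fixed-parameter tractable (FPT) with respect to a parameter $\ell$ if it can be decided in time $f(\ell)\cdot|I|^{c}$ for a computable function $f$ and a constant $c$. *)

theory Defs
  imports Main
begin

text \<open>A finite undirected loopless graph on vertex set {0..<n}, given by a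
symmetric irreflexive adjacency predicate E (only values on {0..<n} matter).\<close>

definition is_graph :: "nat \<Rightarrow> (nat \<Rightarrow> nat \<Rightarrow> bool) \<Rightarrow> bool" where
  "is_graph n E \<longleftrightarrow> (\<forall>u<n. \<forall>v<n. E u v \<longleftrightarrow> E v u) \<and> (\<forall>v<n. \<not> E v v)"

definition vertex_cover :: "nat \<Rightarrow> (nat \<Rightarrow> nat \<Rightarrow> bool) \<Rightarrow> nat set \<Rightarrow> bool" where
  "vertex_cover n E X \<longleftrightarrow> X \<subseteq> {0..<n} \<and> (\<forall>u<n. \<forall>v<n. E u v \<longrightarrow> u \<in> X \<or> v \<in> X)"

definition degree :: "nat \<Rightarrow> (nat \<Rightarrow> nat \<Rightarrow> bool) \<Rightarrow> nat \<Rightarrow> nat" where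
  "degree n E v = card {u. u < n \<and> E v u}"

definition h_index :: "nat \<Rightarrow> (nat \<Rightarrow> nat \<Rightarrow> bool) \<Rightarrow> nat" where
  "h_index n E = (GREATEST k. k \<le> card {v. v < n \<and> k \<le> degree n E v})"

datatype sym = Bl | B0 | B1 | Sep
datatype dir = Lft | Rgt

text \<open>A machine: finitely many states {0..<tm_states}, start state 0,
halting states 1 (accept) and 2 (reject); transition function.\<close>
record tm =
  tm_states :: nat
  tm_delta :: "nat \<Rightarrow> sym \<Rightarrow> nat \<times> sym \<times> dir"

definition wf_tm :: "tm \<Rightarrow> bool" where
  "wf_tm M \<longleftrightarrow> 3 \<le> tm_states M \<and> (\<forall>q s. fst (tm_delta M q s) < tm_states M)"

type_synonym config = "nat \<times> sym list \<times> sym list"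
  \<comment> \<open>state, tape left of head (nearest cell first), tape from head rightwards\<close>

fun read :: "sym list \<Rightarrow> sym" where
  "read [] = Bl" | "read (x # _) = x"

fun write_mv :: "sym \<Rightarrow> dir \<Rightarrow> sym list \<Rightarrow> sym list \<Rightarrow> sym list \<times> sym list" where
  "write_mv s Lft [] r = ([], Bl # s # tl r)"
| "write_mv s Lft (x # l) r = (l, x # s # tl r)"
| "write_mv s Rgt l r = (s # l, tl r)"

definition step :: "tm \<Rightarrow> config \<Rightarrow> config" where
  "step M c = (case c of (q, l, r) \<Rightarrow>
     if q = 1 \<or> q = 2 then c
     else (case tm_delta M q (read r) of (q', s, d) \<Rightarrow>
             (q', write_mv s d l r)))"

definition run :: "tm \<Rightarrow> nat \<Rightarrow> sym list \<Rightarrow> config" where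
  "run M t w = (step M ^^ t) (0, [], w)"

definition state_of :: "config \<Rightarrow> nat" where
  "state_of c = fst c"

definition accepts_within :: "tm \<Rightarrow> sym list \<Rightarrow> nat \<Rightarrow> bool" where
  "accepts_within M w t \<longleftrightarrow> state_of (run M t w) = 1"

definition rejects_within :: "tm \<Rightarrow> sym list \<Rightarrow> nat \<Rightarrow> bool" where
  "rejects_within M w t \<longleftrightarrow> state_of (run M t w) = 2"

definition computable :: "(nat \<Rightarrow> nat) \<Rightarrow> bool" where
  "computable f \<longleftrightarrow> (\<exists>M. wf_tm M \<and> (\<forall>n. \<exists>t.
      (case run M t (replicate n B1) of (q, l, r) \<Rightarrow>
         q = 1 \<and> length (filter (\<lambda>x. x = B1) (l @ r)) = f n)))"

fun bin :: "nat \<Rightarrow> sym list" where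
  "bin k = (if k = 0 then [] else (if k mod 2 = 1 then B1 else B0) # bin (k div 2))"

definition encode :: "nat \<Rightarrow> (nat \<Rightarrow> nat \<Rightarrow> bool) \<Rightarrow> nat \<Rightarrow> sym list" where
  "encode n E k = replicate n B1 @ [Sep]
     @ concat (map (\<lambda>i. map (\<lambda>j. if E i j then B1 else B0) [0..<n]) [0..<n])
     @ [Sep] @ bin k"

end

theory Submission
  imports Defs "HOL-Library.More_List"
begin

text \<open>
  Let \<open>l\<close> be such that at least \<open>k - l\<close> vertices have degree at least \<open>k - l\<close>; the least such \<open>l\<close> is at
  most \<open>k - h(G)\<close>. A vertex cover of size at most \<open>k\<close> either contains all these vertices, or misses one of
  them and then contains its whole neighbourhood. Each of these at most \<open>n + 1\<close> sets leaves a budget of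
  at most \<open>l\<close> further vertices, so \<open>2^l\<close> runs of the usual branching on an uncovered edge decide each case.

  The algorithm is written in a small imperative language with unary registers and bit arrays, which is
  compiled to Turing machines. Registers and arrays are interleaved tracks to the left of the input, and the
  finite control of the machine consists of the continuations of the program. A program that performs \<open>t\<close>
  operations never has a register exceeding \<open>t\<close>, hence it runs in \<open>O(t^2)\<close> machine steps; no further
  bookkeeping of machine time is needed.

  The function \<open>f\<close> is whatever number of ones a compiled program leaves on the tape after computing
  \<open>4^l\<close> in a register: it is computable by construction and at least \<open>4^l\<close>.
\<close>

section \<open>Machines with stay moves and arbitrary finite control\<close>

text \<open>The h-index itself is never computed: the program raises \<open>l\<close> from 0 until
  enough vertices qualify, and \<open>k - h(G)\<close>, truncated at 0, is one value that qualifies.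
  Since \<open>k\<close> is given in binary, it is cut off at \<open>n\<close> before any unary
  arithmetic; this only decreases the parameter. The quadratic slowdown squares the
  \<open>2^l\<close> branchings, which is the origin of \<open>4^l\<close>. Constant factors do not
  enter \<open>f\<close>: an encoded instance has at least two symbols, so a constant
  \<open>d\<close> is at most \<open>N ^ d\<close> for its length \<open>N\<close> and moves into
  the exponent. The value of a computable function is the number of ones on the whole final tape,
  including those of all other tracks. An exact value would require cleaning up; a function above
  \<open>4^l\<close> suffices, because a halted machine keeps its state and a larger time bound does
  no harm. The machines of the statement know cells only relative to the head. Tapes over the
  integers give every register entry a fixed address.\<close>

type_synonym tape = "int \<Rightarrow> sym"
datatype move = MvL | MvS | MvR
type_synonym 'q machine = "'q \<Rightarrow> sym \<Rightarrow> 'q \<times> sym \<times> move"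
type_synonym 'q conf = "'q \<times> int \<times> tape"

fun shift :: "move \<Rightarrow> int" where
  "shift MvL = -1" | "shift MvS = 0" | "shift MvR = 1"

fun mstep :: "'q machine \<Rightarrow> 'q conf \<Rightarrow> 'q conf" where
  "mstep d (q, p, T) = (case d q (T p) of (q', x, m) \<Rightarrow> (q', p + shift m, T(p := x)))"

text \<open>An upper bound on the number of steps lets the costs of consecutive phases combine by
  inequalities.\<close>

definition reaches :: "'q machine \<Rightarrow> nat \<Rightarrow> 'q conf \<Rightarrow> 'q conf \<Rightarrow> bool" where
  "reaches d t c c' \<longleftrightarrow> (\<exists>t'\<le>t. (mstep d ^^ t') c = c')"

lemma reaches_refl: "reaches d t c c"
  unfolding reaches_def by (intro exI[of _ 0]) auto

lemma reaches_mono: "reaches d t c c' \<Longrightarrow> t \<le> u \<Longrightarrow> reaches d u c c'"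
  unfolding reaches_def using order_trans by blast

lemma reaches_trans:
  assumes "reaches d t c c'" "reaches d u c' c''" "t + u \<le> v"
  shows "reaches d v c c''"
proof -
  obtain a b where "a \<le> t" "(mstep d ^^ a) c = c'" "b \<le> u" "(mstep d ^^ b) c' = c''"
    using assms unfolding reaches_def by auto
  then have "(mstep d ^^ (b + a)) c = c''" "b + a \<le> v" using assms by (auto simp: funpow_add)
  then show ?thesis unfolding reaches_def by blast
qed

lemma reaches_step:
  assumes "d q (T p) = (q', x, m)" "reaches d t (q', p + shift m, T(p := x)) c'" "Suc t \<le> v"
  shows "reaches d v (q, p, T) c'"
proof -
  have "reaches d 1 (q, p, T) (q', p + shift m, T(p := x))"
    unfolding reaches_def using assms(1) by (intro exI[of _ 1]) auto
  then show ?thesis using reaches_trans assms(2,3) by fastforce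
qed

definition tape_of :: "sym list \<Rightarrow> tape" where
  "tape_of w z = (if z < 0 then Bl else nth_default Bl w (nat z))"

text \<open>The lists of a configuration describe a tape only up to trailing blanks and relative to
  the head. Padding with \<open>nth_default Bl\<close> forgets the former, the absolute position
  \<open>p\<close> supplies the latter.\<close>

definition on_tape :: "int \<Rightarrow> tape \<Rightarrow> sym list \<Rightarrow> sym list \<Rightarrow> bool" where
  "on_tape p T l r \<longleftrightarrow> (\<forall>i. T (p + int i) = nth_default Bl r i) \<and>
     (\<forall>i. T (p - 1 - int i) = nth_default Bl l i)"

lemma on_tape_init: "on_tape 0 (tape_of w) [] w"
  by (auto simp: on_tape_def tape_of_def)

lemma read_on_tape: "on_tape p T l r \<Longrightarrow> read r = T p"
proof -
  assume "on_tape p T l r"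
  then have "T (p + int 0) = nth_default Bl r 0" unfolding on_tape_def by blast
  then show ?thesis by (cases r) auto
qed

lemma nth_default_tl: "nth_default x (tl r) i = nth_default x r (Suc i)"
  by (cases r) auto

lemma write_right_on_tape:
  assumes "on_tape p T l r" "write_mv s Rgt l r = (l', r')"
  shows "on_tape (p + 1) (T(p := s)) l' r'"
proof -
  have r: "\<And>i. T (p + int i) = nth_default Bl r i"
    and l: "\<And>i. T (p - 1 - int i) = nth_default Bl l i"
    using assms(1) unfolding on_tape_def by auto
  have "T (p + 1 + int i) = nth_default Bl (tl r) i" for i
    using r[of "Suc i"] by (simp add: nth_default_tl algebra_simps)
  moreover have "(T(p := s)) (p + 1 - 1 - int i) = nth_default Bl (s # l) i" for i
  proof (cases i)
    case (Suc j)
    then show ?thesis using l[of j] by (simp add: algebra_simps)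
  qed simp
  ultimately show ?thesis using assms(2) unfolding on_tape_def by auto
qed

lemma write_left_on_tape:
  assumes "on_tape p T l r" "write_mv s Lft l r = (l', r')"
  shows "on_tape (p - 1) (T(p := s)) l' r'"
proof -
  have r: "\<And>i. T (p + int i) = nth_default Bl r i"
    and l: "\<And>i. T (p - 1 - int i) = nth_default Bl l i"
    using assms(1) unfolding on_tape_def by auto
  have lr: "l' = tl l" "r' = read l # s # tl r" using assms(2) by (cases l; auto)+
  have "T (p - 1 - 1 - int i) = nth_default Bl (tl l) i" for i
    using l[of "Suc i"] by (simp add: nth_default_tl algebra_simps)
  moreover have "(T(p := s)) (p - 1 + int i) = nth_default Bl (read l # s # tl r) i" for i
  proof (cases i)
    case 0
    then show ?thesis using l[of 0] by (cases l) auto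
  next
    case (Suc j)
    show ?thesis
    proof (cases j)
      case (Suc m)
      have "p - 1 + int i = p + int (Suc m)" using Suc \<open>i = Suc j\<close> by simp
      then show ?thesis using r[of "Suc m"] Suc \<open>i = Suc j\<close> 
        by (simp add: nth_default_tl algebra_simps)
    qed (use Suc in simp)
  qed
  ultimately show ?thesis using lr unfolding on_tape_def by auto
qed

fun to_tm_delta :: "'q machine \<Rightarrow> ('q + 'q) \<Rightarrow> sym \<Rightarrow> ('q + 'q) \<times> sym \<times> dir" where
  "to_tm_delta d (Inl q) s = (case d q s of (q', x, m) \<Rightarrow>
     (case m of MvL \<Rightarrow> (Inl q', x, Lft) | MvR \<Rightarrow> (Inl q', x, Rgt) | MvS \<Rightarrow> (Inr q', x, Rgt)))"
| "to_tm_delta d (Inr q) s = (Inl q, s, Lft)"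

lemma funpow_fixed: "f x = x \<Longrightarrow> (f ^^ n) x = x"
  by (induction n) auto

text \<open>A stay move becomes a step to the right followed by a step back, which explains the factor 2.\<close>

theorem machine_to_tm:
  fixes d :: "'q machine"
  assumes fin: "finite Q" and Q: "q0 \<in> Q" "qa \<in> Q" "qr \<in> Q"
    and dist: "q0 \<noteq> qa" "q0 \<noteq> qr" "qa \<noteq> qr"
    and closed: "\<And>q s. q \<in> Q \<Longrightarrow> fst (d q s) \<in> Q"
    and halt: "\<And>s. d qa s = (qa, s, MvS)" "\<And>s. d qr s = (qr, s, MvS)"
  shows "\<exists>M. wf_tm M \<and> (\<forall>w q p T t u. reaches d t (q0, 0, tape_of w) (q, p, T) \<longrightarrow>
    q \<in> {qa, qr} \<longrightarrow> 2 * t \<le> u \<longrightarrow>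
    (\<exists>l r. run M u w = (if q = qa then 1 else 2, l, r) \<and> on_tape p T l r))"
proof -
  let ?Q = "Q <+> Q"
  \<comment> \<open>The numbers 0, 1 and 2 are reserved for the start state and the halting states;
    \<open>h\<close> numbers the rest, shifted by 3.\<close>
  define R where "R = ?Q - {Inl q0, Inl qa, Inl qr}"
  have "finite R" unfolding R_def using fin by auto
  then obtain h where h: "bij_betw h R {0..<card R}" using ex_bij_betw_finite_nat by blast
  define g where "g x = (if x = Inl q0 then 0 else if x = Inl qa then 1 else if x = Inl qr then 2
    else h x + 3)" for x
  have inj: "inj_on g ?Q"
  proof (rule inj_onI)
    fix x y
    assume xy: "x \<in> ?Q" "y \<in> ?Q" "g x = g y"
    show "x = y"
    proof (cases "x \<in> R \<and> y \<in> R")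
      case True
      then have "h x = h y" using xy(3) by (simp add: g_def R_def)
      then show ?thesis using h True unfolding bij_betw_def inj_on_def by blast
    qed (use xy in \<open>auto simp: g_def R_def split: if_splits\<close>)
  qed
  have hlt: "h x < card R" if "x \<in> R" for x using h that unfolding bij_betw_def by fastforce
  have glt: "g x < card R + 3" if "x \<in> ?Q" for x
    using hlt[of x] that unfolding g_def R_def by auto
  have cl: "fst (to_tm_delta d x s) \<in> ?Q" if "x \<in> ?Q" for x s
  proof (cases x)
    case (Inl q)
    then have "fst (d q s) \<in> Q" using closed that by auto
    then show ?thesis using Inl by (auto split: prod.splits move.splits)
  next
    case (Inr q)
    then show ?thesis using that by auto
  qed
  \<comment> \<open>\<open>wf_tm\<close> quantifies over all numbers, also those that denote no
    state; these are sent to 0.\<close>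
  define M where "M = \<lparr>tm_states = card R + 3, tm_delta = (\<lambda>n s.
    if n \<in> g ` ?Q then (case to_tm_delta d (inv_into ?Q g n) s of (x, y, z) \<Rightarrow> (g x, y, z))
    else (0, s, Rgt))\<rparr>"
  have wf: "wf_tm M"
    unfolding wf_tm_def
  proof (intro conjI allI)
    fix n s
    show "fst (tm_delta M n s) < tm_states M"
    proof (cases "n \<in> g ` ?Q")
      case True
      then have "inv_into ?Q g n \<in> ?Q" by (rule inv_into_into)
      from glt[OF cl[OF this, of s]] True show ?thesis by (auto simp: M_def split: prod.splits)
    qed (simp add: M_def)
  qed (simp add: M_def)
  have delta: "tm_delta M (g x) s = (case to_tm_delta d x s of (x, y, z) \<Rightarrow> (g x, y, z))"
    if "x \<in> ?Q" for x s using that inj by (simp add: M_def)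
  have g12: "g x = 1 \<longleftrightarrow> x = Inl qa" "g x = 2 \<longleftrightarrow> x = Inl qr" for x
    using dist by (auto simp: g_def)
  have sim: "\<exists>j\<le>2. \<exists>q' p' T' l' r'. mstep d (q, p, T) = (q', p', T') \<and> q' \<in> Q \<and>
      (step M ^^ j) (g (Inl q), l, r) = (g (Inl q'), l', r') \<and> on_tape p' T' l' r'"
    if q: "q \<in> Q" and tp: "on_tape p T l r" for q p T l r
  proof (cases "q = qa \<or> q = qr")
    \<comment> \<open>\<open>step\<close> freezes a halted configuration and \<open>d\<close> loops
      there, so zero steps simulate the stay move.\<close>
    case True
    then have "mstep d (q, p, T) = (q, p, T)" using halt by auto
    then show ?thesis using q tp by (intro exI[of _ 0]) auto
  next
    case False
    then have ng: "g (Inl q) \<noteq> 1" "g (Inl q) \<noteq> 2" using g12 by auto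
    obtain q' x m where dq: "d q (T p) = (q', x, m)" by (metis prod_cases3)
    have q': "q' \<in> Q" using closed[OF q, of "T p"] dq by auto
    have rd: "read r = T p" using read_on_tape[OF tp] .
    have ms: "mstep d (q, p, T) = (q', p + shift m, T(p := x))" using dq by simp
    show ?thesis
    proof (cases m)
      case MvL
      obtain l' r' where lr: "write_mv x Lft l r = (l', r')" by (metis prod.exhaust)
      have "step M (g (Inl q), l, r) = (g (Inl q'), l', r')"
        using ng q dq MvL rd lr by (simp add: step_def delta InlI InrI)
      moreover have "on_tape (p - 1) (T(p := x)) l' r'" using write_left_on_tape[OF tp lr] .
      ultimately show ?thesis using ms MvL q' by (intro exI[of _ 1]) auto
    next
      case MvR
      obtain l' r' where lr: "write_mv x Rgt l r = (l', r')" by (metis prod.exhaust)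
      have "step M (g (Inl q), l, r) = (g (Inl q'), l', r')"
        using ng q dq MvR rd lr by (simp add: step_def delta InlI InrI)
      moreover have "on_tape (p + 1) (T(p := x)) l' r'" using write_right_on_tape[OF tp lr] .
      ultimately show ?thesis using ms MvR q' by (intro exI[of _ 1]) auto
    next
      case MvS
      obtain l' r' where lr: "write_mv x Rgt l r = (l', r')" by (metis prod.exhaust)
      have 1: "step M (g (Inl q), l, r) = (g (Inr q'), l', r')"
        using ng q dq MvS rd lr by (simp add: step_def delta InlI InrI)
      have tp1: "on_tape (p + 1) (T(p := x)) l' r'" using write_right_on_tape[OF tp lr] .
      obtain l2 r2 where lr2: "write_mv (read r') Lft l' r' = (l2, r2)" by (metis prod.exhaust)
      have ng': "g (Inr q') \<noteq> 1" "g (Inr q') \<noteq> 2" using g12 by auto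
      have 2: "step M (g (Inr q'), l', r') = (g (Inl q'), l2, r2)"
        using ng' q' lr2 by (simp add: step_def delta InlI InrI)
      have "on_tape (p + 1 - 1) ((T(p := x))(p + 1 := read r')) l2 r2"
        using write_left_on_tape[OF tp1 lr2] .
      then have "on_tape p (T(p := x)) l2 r2" unfolding read_on_tape[OF tp1] fun_upd_triv by simp
      moreover have "(step M ^^ 2) (g (Inl q), l, r) = (g (Inl q'), l2, r2)"
        using 1 2 by (simp add: numeral_2_eq_2)
      ultimately show ?thesis using ms MvS q' by (intro exI[of _ 2]) auto
    qed
  qed
  have sims: "\<exists>j\<le>2*t. \<exists>q' p' T' l' r'. (mstep d ^^ t) (q0, 0, tape_of w) = (q', p', T') \<and> q' \<in> Q \<and>
      (step M ^^ j) (0, [], w) = (g (Inl q'), l', r') \<and> on_tape p' T' l' r'" for t w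
  proof (induction t)
    case 0
    have "g (Inl q0) = 0" by (simp add: g_def)
    then show ?case using on_tape_init Q by auto
  next
    case (Suc t)
    then obtain j q p T l r where *: "j \<le> 2*t" "(mstep d ^^ t) (q0, 0, tape_of w) = (q, p, T)" "q \<in> Q"
      "(step M ^^ j) (0, [], w) = (g (Inl q), l, r)" "on_tape p T l r" by blast
    from sim[OF *(3,5)] obtain i q' p' T' l' r' where **: "i \<le> 2" "mstep d (q, p, T) = (q', p', T')" "q' \<in> Q"
      "(step M ^^ i) (g (Inl q), l, r) = (g (Inl q'), l', r')" "on_tape p' T' l' r'" by blast
    have "(step M ^^ (i + j)) (0, [], w) = (g (Inl q'), l', r')"
      unfolding funpow_add using * ** by simp
    moreover have "i + j \<le> 2 * Suc t" using * ** by simp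
    moreover have "(mstep d ^^ Suc t) (q0, 0, tape_of w) = (q', p', T')" using * ** by simp
    ultimately show ?case using ** by blast
  qed
  have "\<exists>l r. run M u w = (if q = qa then 1 else 2, l, r) \<and> on_tape p T l r"
    if rch: "reaches d t (q0, 0, tape_of w) (q, p, T)" and "q \<in> {qa, qr}" "2 * t \<le> u" for w q p T t u
  proof -
    obtain t' where t': "t' \<le> t" "(mstep d ^^ t') (q0, 0, tape_of w) = (q, p, T)"
      using rch unfolding reaches_def by auto
    with sims[of t' w] obtain j l r where j: "j \<le> 2*t'"
      "(step M ^^ j) (0, [], w) = (g (Inl q), l, r)" "on_tape p T l r" by auto
    have "g (Inl q) = (if q = qa then 1 else 2)" using that dist by (auto simp: g_def)
    then have e: "(step M ^^ j) (0, [], w) = (if q = qa then 1 else 2, l, r)" using j by simp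
    \<comment> \<open>Halted configurations are fixed points, so the outcome persists up to the
      prescribed time \<open>u\<close>.\<close>
    have fx: "step M (if q = qa then 1 else 2, l, r) = (if q = qa then 1 else 2, l, r)"
      by (simp add: step_def)
    have "u = (u - j) + j" using j t' that by simp
    then have "(step M ^^ u) (0, [], w) = (step M ^^ (u - j)) ((step M ^^ j) (0, [], w))"
      by (metis comp_apply funpow_add)
    then show ?thesis using e funpow_fixed[of "step M", OF fx] j(3) unfolding run_def by simp
  qed
  then show ?thesis using wf by blast
qed

section \<open>An imperative language with unary registers and bit arrays\<close>

datatype reg = rN | rK | rL | rC | rI | rJ | rP | rT | rU | rQ | rD | rM | rW | rO | rR | rZ | rE | rV
datatype ary = aG | aB | aX
datatype track = Num reg | Arr ary

text \<open>Roles in the vertex cover program: \<open>rN\<close>, \<open>rK\<close>,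
  \<open>rL\<close> hold \<open>n\<close>, the capped \<open>k\<close> and \<open>l\<close>;
  \<open>rI\<close>, \<open>rJ\<close> run over vertices; \<open>rP\<close> ends up as
  \<open>n * n\<close>; \<open>rQ\<close> is a power of two while \<open>k\<close> is read and a
  matrix position afterwards; \<open>rT\<close>, \<open>rU\<close> are scratch, and
  \<open>rT\<close> numbers the branchings; \<open>rD\<close> counts a degree or a cover;
  \<open>rE\<close> is \<open>l\<close> plus the number of vertices of high degree;
  \<open>rW\<close> is the write position in row \<open>n\<close>; \<open>rC\<close>,
  \<open>rO\<close> are the starting row and its offset, \<open>rV\<close> is \<open>n + 1\<close>;
  \<open>rM\<close> is a position in \<open>aB\<close>; \<open>rR\<close> counts successes and
  \<open>rZ\<close> stays 0. \<open>aG\<close> is the matrix, \<open>aB\<close> the counter of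
  branching choices, \<open>aX\<close> the current partial cover.\<close>

record store =
  num :: "reg \<Rightarrow> nat"
  arr :: "ary \<Rightarrow> nat \<Rightarrow> bool"
  inp :: "sym list"

text \<open>\<open>Get c y\<close> tests whether the next input symbol differs from \<open>y\<close>, and consumes it if \<open>c\<close>.\<close>

datatype prim = Inc reg | Zero reg | Set ary reg bool | Lt reg reg | Bit ary reg | Get bool sym

fun pok :: "prim \<Rightarrow> store \<Rightarrow> bool" where
  "pok (Get c y) s = (inp s \<noteq> [])"
| "pok _ s = True"

text \<open>For \<open>Inc\<close>, \<open>Zero\<close> and \<open>Set\<close> the result is the bit
  found on the target track before it is overwritten. So every walk of the head returns what it
  reads there, and one simulation lemma serves all of them.\<close>

fun pres :: "prim \<Rightarrow> store \<Rightarrow> bool" where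
  "pres (Inc x) s = False"
| "pres (Zero x) s = False"
| "pres (Set a x b) s = arr s a (num s x)"
| "pres (Lt x y) s = (num s x < num s y)"
| "pres (Bit a x) s = arr s a (num s x)"
| "pres (Get c y) s = (hd (inp s) \<noteq> y)"

fun peff :: "prim \<Rightarrow> store \<Rightarrow> store" where
  "peff (Inc x) s = s\<lparr>num := (num s)(x := Suc (num s x))\<rparr>"
| "peff (Zero x) s = s\<lparr>num := (num s)(x := 0)\<rparr>"
| "peff (Set a x b) s = s\<lparr>arr := (arr s)(a := (arr s a)(num s x := b))\<rparr>"
| "peff (Lt x y) s = s"
| "peff (Bit a x) s = s"
| "peff (Get c y) s = (if c then s\<lparr>inp := tl (inp s)\<rparr> else s)"

datatype com = Do prim | Seq com com (infixr ";;" 60) | Ite prim com com | While prim com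

text \<open>A test takes effect even if it fails: a loop on \<open>Get True Sep\<close> consumes the
  separator that ends it. A sequence is charged one step, in which the control unfolds it.\<close>

inductive exec :: "com \<Rightarrow> store \<Rightarrow> nat \<Rightarrow> store \<Rightarrow> bool" where
  Do: "pok p s \<Longrightarrow> exec (Do p) s 1 (peff p s)"
| Seq: "exec c s t s1 \<Longrightarrow> exec d s1 u s2 \<Longrightarrow> exec (c ;; d) s (t + u + 1) s2"
| Ite: "pok p s \<Longrightarrow> exec (if pres p s then c else d) (peff p s) t s2 \<Longrightarrow> exec (Ite p c d) s (t + 1) s2"
| WhileF: "pok p s \<Longrightarrow> \<not> pres p s \<Longrightarrow> exec (While p c) s 1 (peff p s)"
| WhileT: "pok p s \<Longrightarrow> pres p s \<Longrightarrow> exec c (peff p s) t s1 \<Longrightarrow> exec (While p c) s1 u s2 \<Longrightarrow>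
    exec (While p c) s (t + u + 1) s2"

section \<open>Compilation\<close>

lemma finite_track: "finite (UNIV :: track set)"
proof -
  have "(UNIV :: reg set) = {rN, rK, rL, rC, rI, rJ, rP, rT, rU, rQ, rD, rM, rW, rO, rR, rZ, rE, rV}"
    using reg.exhaust by blast
  moreover have "(UNIV :: ary set) = {aG, aB, aX}"
    using ary.exhaust by blast
  moreover have "(UNIV :: track set) = range Num \<union> range Arr"
    using track.exhaust by blast
  ultimately show ?thesis by (metis finite.emptyI finite_Un finite_imageI finite_insert)
qed

section \<open>Interleaved tracks on the tape\<close>

definition width :: nat where "width = card (UNIV :: track set)"
definition idx :: "track \<Rightarrow> nat" where
  "idx = (SOME f. bij_betw f UNIV {0..<card (UNIV :: track set)})"

lemma bij_idx: "bij_betw idx UNIV {0..<width}"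
  unfolding idx_def width_def using someI_ex[OF ex_bij_betw_finite_nat[OF finite_track]] .

lemma idx_less: "idx t < width"
  using bij_idx unfolding bij_betw_def by auto

lemma inv_idx: "inv idx (idx t) = t"
  using bij_idx unfolding bij_betw_def by simp

definition bit_sym :: "bool \<Rightarrow> sym" where "bit_sym b = (if b then B1 else Bl)"

lemma bit_sym_simps [simp]: "bit_sym b = B1 \<longleftrightarrow> b" "bit_sym b \<noteq> Sep" "Sep \<noteq> bit_sym b"
  "bit_sym True = B1" "bit_sym False = Bl"
  by (auto simp: bit_sym_def)

text \<open>Entry \<open>i\<close> of the track with index \<open>j < width\<close> is kept in cell \<open>-2 - (i * width + j)\<close>, cell \<open>-1\<close>
  is the home position, marked by \<open>Sep\<close>, and the input lies to the right of it,
  its \<open>p\<close> consumed symbols being blanked out.\<close>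

definition layout :: "(track \<Rightarrow> nat \<Rightarrow> bool) \<Rightarrow> nat \<Rightarrow> sym list \<Rightarrow> tape" where
  "layout f p w z = (if z < -1 then bit_sym (f (inv idx (nat (-2 - z) mod width)) (nat (-2 - z) div width))
     else if z = -1 then Sep else if z < int p then Bl else nth_default Bl w (nat z - p))"

text \<open>Also used with \<open>j = width\<close>, which denotes the first cell of the next block,
  so that a walk may cross the border of a block without a change of address.\<close>

definition tpos :: "nat \<Rightarrow> nat \<Rightarrow> int" where "tpos i j = -2 - int (i * width + j)"

lemma tpos_less: "tpos i j < -1"
  unfolding tpos_def by linarith

lemma nat_tpos: "nat (-2 - tpos i j) = i * width + j"
  unfolding tpos_def by linarith

lemma tpos_Suc: "tpos i j - 1 = tpos i (Suc j)" by (simp add: tpos_def)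

lemma tpos_wrap: "tpos i width = tpos (Suc i) 0" by (simp add: tpos_def)

lemma layout_track [simp]: "layout f p w (tpos i (idx t)) = bit_sym (f t i)"
  using idx_less[of t] tpos_less[of i "idx t"] by (simp add: layout_def nat_tpos inv_idx)

lemma layout_not_Sep: "z < -1 \<Longrightarrow> layout f p w z \<noteq> Sep"
  by (simp add: layout_def)

lemma layout_home [simp]: "layout f p w (-1) = Sep"
  by (simp add: layout_def)

text \<open>By uniqueness of division with remainder, different pairs of a block and a track occupy
  different cells; hence one write changes one entry of one track.\<close>

lemma layout_update:
  "(layout f p w)(tpos i (idx t) := bit_sym b) = layout (f(t := (f t)(i := b))) p w"
proof
  fix z
  show "((layout f p w)(tpos i (idx t) := bit_sym b)) z = layout (f(t := (f t)(i := b))) p w z"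
  proof (cases "z < -1 \<and> z \<noteq> tpos i (idx t)")
    case True
    define m where "m = nat (-2 - z)"
    have "m \<noteq> i * width + idx t" using True unfolding m_def tpos_def by linarith
    moreover have "m = m div width * width + m mod width" by simp
    moreover have "m mod width < width" using idx_less[of t] by simp
    moreover have "inv idx (m mod width) = t \<Longrightarrow> idx t = m mod width"
      using bij_idx \<open>m mod width < width\<close>
      unfolding bij_betw_def by (metis atLeastLessThan_iff f_inv_into_f le0)
    ultimately have "inv idx (m mod width) \<noteq> t \<or> m div width \<noteq> i" by metis
    then show ?thesis using True by (auto simp: layout_def m_def)
  next
    case False
    then show ?thesis using tpos_less[of i "idx t"] idx_less[of t]
      by (auto simp: layout_def nat_tpos inv_idx)
  qed
qed

text \<open>The state records the track under the head, the remaining distance to the target track,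
  or the result on the way home. The unbounded block number is kept by the head position alone, so
  finitely many states are enough.\<close>

datatype micro = Start | Walk nat | GoL nat | GoR nat | Ret bool | Rt | Lf bool

fun wtrack :: "prim \<Rightarrow> track" where
  "wtrack (Inc x) = Num x" | "wtrack (Zero x) = Num x" | "wtrack (Set a x b) = Num x"
| "wtrack (Lt x y) = Num x" | "wtrack (Bit a x) = Num x" | "wtrack (Get c y) = undefined"

fun ttrack :: "prim \<Rightarrow> track" where
  "ttrack (Inc x) = Num x" | "ttrack (Zero x) = Num x" | "ttrack (Set a x b) = Arr a"
| "ttrack (Lt x y) = Num y" | "ttrack (Bit a x) = Arr a" | "ttrack (Get c y) = undefined"

fun wsym :: "prim \<Rightarrow> sym \<Rightarrow> sym" where
  "wsym (Inc x) s = B1" | "wsym (Zero x) s = Bl" | "wsym (Set a x b) s = bit_sym b"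
| "wsym (Lt x y) s = s" | "wsym (Bit a x) s = s" | "wsym (Get c y) s = (if c then Bl else s)"

fun is_zero :: "prim \<Rightarrow> bool" where
  "is_zero (Zero x) = True" | "is_zero _ = False"

fun is_get :: "prim \<Rightarrow> bool" where
  "is_get (Get c y) = True" | "is_get _ = False"

fun get_sym :: "prim \<Rightarrow> sym" where
  "get_sym (Get c y) = y" | "get_sym _ = Bl"

text \<open>A walk goes left along \<open>wtrack\<close> up to the first block \<open>i\<close> whose bit is not set (so \<open>i\<close> is the
  value of the register), moves to \<open>ttrack\<close> within that block, reads and writes there, and returns home.\<close>

fun micro_delta :: "prim \<Rightarrow> micro \<Rightarrow> sym \<Rightarrow> (micro + bool) \<times> sym \<times> move" where
  "micro_delta p Start s = (if is_get p then (Inl Rt, s, MvR) else (Inl (Walk 0), s, MvL))"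
| "micro_delta p (Walk j) s =
    (if j \<noteq> idx (wtrack p) then (Inl (Walk (Suc j mod width)), s, MvL)
     else if s = B1 then (Inl (Walk (Suc j mod width)), if is_zero p then Bl else B1, MvL)
     else if idx (ttrack p) \<ge> j then (Inl (GoL (idx (ttrack p) - j)), s, MvS)
     else (Inl (GoR (j - idx (ttrack p))), s, MvS))"
| "micro_delta p (GoL j) s =
    (if j = 0 then (Inl (Ret (s = B1)), wsym p s, MvR) else (Inl (GoL (j - 1)), s, MvL))"
| "micro_delta p (GoR j) s =
    (if j = 0 then (Inl (Ret (s = B1)), wsym p s, MvR) else (Inl (GoR (j - 1)), s, MvR))"
| "micro_delta p (Ret b) s = (if s = Sep then (Inr b, s, MvS) else (Inl (Ret b), s, MvR))"
| "micro_delta p Rt s =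
    (if s = Bl then (Inl Rt, s, MvR) else (Inl (Lf (s \<noteq> get_sym p)), wsym p s, MvL))"
| "micro_delta p (Lf b) s = (if s = Sep then (Inr b, s, MvS) else (Inl (Lf b), s, MvL))"

section \<open>Control states and the compiled machine\<close>

datatype ctl = Run "com list" | Yes | No
datatype mstate = Init1 | Init2 | St ctl micro

text \<open>The empty continuation performs the final test: accept iff register \<open>rR\<close> exceeds \<open>rZ\<close>.\<close>

fun prim_of :: "com list \<Rightarrow> prim" where
  "prim_of [] = Lt rZ rR"
| "prim_of (Do p # K) = p"
| "prim_of (Ite p c d # K) = p"
| "prim_of (While p c # K) = p"
| "prim_of ((c ;; d) # K) = undefined"

fun next_ctl :: "com list \<Rightarrow> bool \<Rightarrow> ctl" where
  "next_ctl [] b = (if b then Yes else No)"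
| "next_ctl (Do p # K) b = Run K"
| "next_ctl (Ite p c d # K) b = Run ((if b then c else d) # K)"
| "next_ctl (While p c # K) b = Run (if b then c # While p c # K else K)"
| "next_ctl ((c ;; d) # K) b = Run (c # d # K)"

fun is_seq :: "com list \<Rightarrow> bool" where
  "is_seq ((c ;; d) # K) = True" | "is_seq _ = False"

text \<open>\<open>Init1\<close> appends a \<open>Sep\<close> to the input, so that the number
  \<open>k\<close> at its end has a terminator as well; \<open>Init2\<close> returns and marks the
  home cell.\<close>

fun compile :: "com \<Rightarrow> mstate machine" where
  "compile c Init1 s = (if s = Bl then (Init2, Sep, MvL) else (Init1, s, MvR))"
| "compile c Init2 s = (if s = Bl then (St (Run [c]) Start, Sep, MvS) else (Init2, s, MvL))"
| "compile c (St Yes m) s = (St Yes m, s, MvS)"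
| "compile c (St No m) s = (St No m, s, MvS)"
| "compile c (St (Run K) m) s = (if is_seq K then (St (next_ctl K True) Start, s, MvS)
    else case micro_delta (prim_of K) m s of (r, x, v) \<Rightarrow>
      (case r of Inl m' \<Rightarrow> St (Run K) m' | Inr b \<Rightarrow> St (next_ctl K b) Start, x, v))"

section \<open>Simulating one primitive operation\<close>

lemma reaches_micro:
  assumes "\<not> is_seq K" "micro_delta (prim_of K) m (T z) = (Inl m', x, v)"
    "reaches (compile c) t (St (Run K) m', z + shift v, T(z := x)) c'" "Suc t \<le> u"
  shows "reaches (compile c) u (St (Run K) m, z, T) c'"
  using reaches_step[of "compile c" "St (Run K) m" T z "St (Run K) m'" x v] assms by simp

lemma reaches_micro_end:
  assumes "\<not> is_seq K" "micro_delta (prim_of K) m (T z) = (Inr b, T z, MvS)" "1 \<le> u"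
  shows "reaches (compile c) u (St (Run K) m, z, T) (St (next_ctl K b) Start, z, T)"
  using reaches_step[of "compile c" "St (Run K) m" T z "St (next_ctl K b) Start" "T z" MvS 0] assms
  by (simp add: reaches_refl)

text \<open>Track cells hold only \<open>B1\<close> and \<open>Bl\<close>, so the first
  \<open>Sep\<close> met on the way right is the home mark.\<close>

lemma reaches_Ret:
  assumes "\<not> is_seq K"
  shows "reaches (compile c) (Suc n) (St (Run K) (Ret b), -1 - int n, layout f p w)
    (St (next_ctl K b) Start, -1, layout f p w)"
proof (induction n)
  case 0
  show ?case using assms by (simp add: reaches_micro_end)
next
  case (Suc n)
  show ?case
    by (rule reaches_micro[OF assms, where t = "Suc n" and v = MvR and m' = "Ret b"
          and x = "layout f p w (-1 - int (Suc n))"])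
      (use Suc in \<open>auto simp: layout_not_Sep\<close>)
qed

text \<open>This is where the blanking of consumed symbols pays off: a consumed separator left in
  place would be mistaken for the home mark.\<close>

lemma reaches_Lf:
  assumes "\<not> is_seq K" "n \<le> p"
  shows "reaches (compile c) (Suc n) (St (Run K) (Lf b), int n - 1, layout f p w)
    (St (next_ctl K b) Start, -1, layout f p w)"
  using assms(2)
proof (induction n)
  case 0
  show ?case using assms by (simp add: reaches_micro_end)
next
  case (Suc n)
  have "layout f p w (int n) = Bl" using Suc.prems by (simp add: layout_def)
  note step = this
  show ?case
    by (rule reaches_micro[OF assms(1), where t = "Suc n" and v = MvL and m' = "Lf b"
          and x = "layout f p w (int n)"])
      (use step Suc in \<open>auto simp: fun_upd_idem\<close>)
qed

lemma reaches_Rt: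
  assumes "\<not> is_seq K" "n \<le> p"
  shows "reaches (compile c) n (St (Run K) Rt, int p - int n, layout f p w)
    (St (Run K) Rt, int p, layout f p w)"
  using assms(2)
proof (induction n)
  case 0
  show ?case by (simp add: reaches_refl)
next
  case (Suc n)
  have "layout f p w (int p - int (Suc n)) = Bl" using Suc.prems by (simp add: layout_def)
  note step = this
  show ?case
    by (rule reaches_micro[OF assms(1), where t = n and v = MvR and m' = Rt
          and x = "layout f p w (int p - int (Suc n))"])
      (use step Suc in \<open>auto simp: fun_upd_idem\<close>)
qed

lemma layout_consume: "(layout f p (x # w))(int p := Bl) = layout f (Suc p) w"
proof
  fix z
  show "((layout f p (x # w))(int p := Bl)) z = layout f (Suc p) w z"
  proof (cases "z > int p")
    case True
    then have "nat z - p = Suc (nat z - Suc p)" by linarith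
    then show ?thesis using True by (simp add: layout_def)
  qed (auto simp: layout_def)
qed

definition tbits :: "store \<Rightarrow> track \<Rightarrow> nat \<Rightarrow> bool" where
  "tbits s t i = (case t of Num x \<Rightarrow> i < num s x | Arr a \<Rightarrow> arr s a i)"

lemma tbits_inp [simp]: "tbits (s\<lparr>inp := w\<rparr>) = tbits s"
  by (auto simp: tbits_def fun_eq_iff split: track.splits)

definition htape :: "store \<Rightarrow> nat \<Rightarrow> tape" where
  "htape s p = layout (tbits s) p (inp s)"

text \<open>Unread input contains no blank, so the first nonblank cell right of home is the next
  symbol. The head crosses the \<open>m\<close> consumed cells on the way there and on the way
  back.\<close>

lemma sim_get:
  assumes K: "\<not> is_seq K" and p: "prim_of K = Get b y" and s: "inp s \<noteq> []" "Bl \<notin> set (inp s)"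
  shows "reaches (compile c) (2 * m + 6) (St (Run K) Start, -1, htape s m)
    (St (next_ctl K (pres (Get b y) s)) Start, -1, htape (peff (Get b y) s) (if b then Suc m else m))"
proof -
  obtain x w where w: "inp s = x # w" using s by (cases "inp s") auto
  then have x: "x \<noteq> Bl" using s by auto
  have lm: "layout f m (x # w) (int m) = x" for f by (simp add: layout_def)
  let ?T = "layout (tbits s) m (x # w)"
  let ?m' = "if b then Suc m else m"
  have T': "?T(int m := if b then Bl else x) = htape (peff (Get b y) s) ?m'"
  proof (cases b)
    case True
    then show ?thesis using layout_consume[of "tbits s" m x w] w
      by (auto simp: htape_def)
  next
    case False
    then show ?thesis using fun_upd_triv[of ?T "int m"] w by (simp add: htape_def lm)
  qed
  have "reaches (compile c) (Suc m) (St (Run K) (Lf (x \<noteq> y)), int m - 1, htape (peff (Get b y) s) ?m')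
    (St (next_ctl K (x \<noteq> y)) Start, -1, htape (peff (Get b y) s) ?m')"
    unfolding htape_def using reaches_Lf[OF K, of m ?m'] by auto
  note step = this
  have "reaches (compile c) (Suc (Suc m)) (St (Run K) Rt, int m, ?T)
    (St (next_ctl K (x \<noteq> y)) Start, -1, htape (peff (Get b y) s) ?m')"
    by (rule reaches_micro[OF K, where t = "Suc m" and v = MvL and m' = "Lf (x \<noteq> y)"
          and x = "if b then Bl else x"]) (use step p x T' in \<open>auto simp: lm\<close>)
  then have "reaches (compile c) (2*m+2) (St (Run K) Rt, 0, ?T)
    (St (next_ctl K (x \<noteq> y)) Start, -1, htape (peff (Get b y) s) ?m')"
    using reaches_trans[OF reaches_Rt[OF K, of m m c "tbits s" "x # w"]] by fastforce
  note step = this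
  show ?thesis unfolding htape_def[of s] w
    by (rule reaches_micro[OF K, where t = "2*m+2" and v = MvR and m' = Rt and x = Sep])
      (use step p w in \<open>auto simp: fun_upd_idem\<close>)
qed

lemma reaches_Walk_skip:
  assumes K: "\<not> is_seq K" and e: "e \<le> width" and o: "\<And>j'. j \<le> j' \<Longrightarrow> j' < e \<Longrightarrow> j' \<noteq> idx (wtrack (prim_of K))"
    and "j \<le> e" "j < width"
  shows "reaches (compile c) (e - j) (St (Run K) (Walk j), tpos i j, T)
    (St (Run K) (Walk (e mod width)), tpos i e, T)"
  using assms(3-)
proof (induction "e - j" arbitrary: j)
  case 0
  then show ?case by (simp add: reaches_refl)
next
  case (Suc n)
  have j: "j < e" using Suc.hyps by simp
  have *: "reaches (compile c) n (St (Run K) (Walk (Suc j mod width)), tpos i (Suc j), T)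
    (St (Run K) (Walk (e mod width)), tpos i e, T)"
  proof (cases "Suc j < width")
    case True
    have n: "n = e - Suc j" using Suc.hyps(2) by simp
    show ?thesis using Suc.hyps(1)[OF n] True Suc.prems j n by auto
  next
    case False
    then have "e = Suc j" using j e Suc.prems by simp
    then show ?thesis by (simp add: reaches_refl)
  qed
  have "reaches (compile c) (Suc n) (St (Run K) (Walk j), tpos i j, T) 
    (St (Run K) (Walk (e mod width)), tpos i e, T)"
    by (rule reaches_micro[OF K, where t = n and v = MvL and m' = "Walk (Suc j mod width)" and x = "T (tpos i j)"])
      (use * Suc.prems j in \<open>auto simp: tpos_Suc\<close>)
  then show ?case using Suc.hyps by simp
qed

text \<open>The tracks after the first \<open>i\<close> blocks of a walk: \<open>Zero\<close> erases the register on the way.\<close>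

definition walked :: "prim \<Rightarrow> (track \<Rightarrow> nat \<Rightarrow> bool) \<Rightarrow> nat \<Rightarrow> track \<Rightarrow> nat \<Rightarrow> bool" where
  "walked p f i = (if is_zero p then f(wtrack p := (\<lambda>k. i \<le> k \<and> f (wtrack p) k)) else f)"

lemma reaches_Walk:
  assumes K: "\<not> is_seq K" and p: "prim_of K = p" and f: "\<And>k. k < i \<Longrightarrow> f (wtrack p) k"
  shows "reaches (compile c) (i * width) (St (Run K) (Walk 0), tpos 0 0, layout f q w)
    (St (Run K) (Walk 0), tpos i 0, layout (walked p f i) q w)"
  using f
proof (induction i)
  case 0
  have "walked p f 0 = f" by (auto simp: walked_def)
  then show ?case by (simp add: reaches_refl)
next
  case (Suc i)
  let ?j = "idx (wtrack p)"
  let ?f = "walked p f i"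
  have j: "?j < width" using idx_less .
  have IH: "reaches (compile c) (i * width) (St (Run K) (Walk 0), tpos 0 0, layout f q w)
    (St (Run K) (Walk 0), tpos i 0, layout ?f q w)" using Suc by simp
  have 1: "reaches (compile c) ?j (St (Run K) (Walk 0), tpos i 0, layout ?f q w)
     (St (Run K) (Walk ?j), tpos i ?j, layout ?f q w)"
    using reaches_Walk_skip[OF K, of ?j 0 c i] p j by auto
  have b: "?f (wtrack p) i" using Suc.prems by (auto simp: walked_def)
  \<comment> \<open>Within a block the walk writes only on the followed track: a blank for
    \<open>Zero\<close>, otherwise the one just read.\<close>
  have upd: "(layout ?f q w)(tpos i ?j := if is_zero p then Bl else B1) = layout (walked p f (Suc i)) q w"
  proof -
    have "?f(wtrack p := (?f (wtrack p))(i := \<not> is_zero p)) = walked p f (Suc i)"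
      using Suc.prems by (auto simp: walked_def fun_eq_iff)
    then show ?thesis using layout_update[of ?f q w i "wtrack p" "\<not> is_zero p"] by (auto simp: bit_sym_def)
  qed
  have 2: "reaches (compile c) (width - Suc ?j) (St (Run K) (Walk (Suc ?j mod width)), tpos i (Suc ?j), layout (walked p f (Suc i)) q w)
     (St (Run K) (Walk 0), tpos (Suc i) 0, layout (walked p f (Suc i)) q w)"
  proof (cases "Suc ?j < width")
    case True
    then show ?thesis using reaches_Walk_skip[OF K, of width "Suc ?j" c i] p by (auto simp: tpos_wrap)
  next
    case False
    then have "Suc ?j = width" using j by simp
    then show ?thesis by (simp add: reaches_refl tpos_wrap)
  qed
  have 3: "reaches (compile c) (Suc (width - Suc ?j)) (St (Run K) (Walk ?j), tpos i ?j, layout ?f q w)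
     (St (Run K) (Walk 0), tpos (Suc i) 0, layout (walked p f (Suc i)) q w)"
    by (rule reaches_micro[OF K, where t = "width - Suc ?j" and v = MvL and m' = "Walk (Suc ?j mod width)"
          and x = "if is_zero p then Bl else B1"])
      (use 2 b upd p in \<open>auto simp: tpos_Suc\<close>)
  have 4: "reaches (compile c) width (St (Run K) (Walk 0), tpos i 0, layout ?f q w)
     (St (Run K) (Walk 0), tpos (Suc i) 0, layout (walked p f (Suc i)) q w)"
    using reaches_trans[OF 1 3] j by simp
  show ?case using reaches_trans[OF IH 4] by simp
qed

lemma reaches_GoL:
  assumes K: "\<not> is_seq K"
  shows "reaches (compile c) n (St (Run K) (GoL n), tpos i j, T) (St (Run K) (GoL 0), tpos i (j + n), T)"
proof (induction n arbitrary: j)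
  case 0
  then show ?case by (simp add: reaches_refl)
next
  case (Suc n)
  show ?case
    by (rule reaches_micro[OF K, where t = n and v = MvL and m' = "GoL n" and x = "T (tpos i j)"])
      (use Suc[of "Suc j"] in \<open>auto simp: tpos_Suc\<close>)
qed

lemma reaches_GoR:
  assumes K: "\<not> is_seq K"
  shows "reaches (compile c) n (St (Run K) (GoR n), tpos i (j + n), T) (St (Run K) (GoR 0), tpos i j, T)"
proof (induction n)
  case 0
  then show ?case by (simp add: reaches_refl)
next
  case (Suc n)
  have "tpos i (j + Suc n) + 1 = tpos i (j + n)" by (simp add: tpos_def)
  note step = this
  show ?case
    by (rule reaches_micro[OF K, where t = n and v = MvR and m' = "GoR n" and x = "T (tpos i (j + Suc n))"])
      (use step Suc in \<open>auto\<close>)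
qed

lemma reaches_act:
  assumes K: "\<not> is_seq K" and p: "prim_of K = p" and m: "m = GoL 0 \<or> m = GoR 0"
    and g: "\<not> is_get p"
    and upd: "(layout f q w)(tpos i (idx (ttrack p)) := wsym p (bit_sym (f (ttrack p) i))) = layout f' q w"
  shows "reaches (compile c) (i * width + width + 3)
    (St (Run K) m, tpos i (idx (ttrack p)), layout f q w)
    (St (next_ctl K (f (ttrack p) i)) Start, -1, layout f' q w)"
proof -
  let ?b = "f (ttrack p) i"
  have "tpos i (idx (ttrack p)) + 1 = -1 - int (i * width + idx (ttrack p))" by (simp add: tpos_def)
  then have "reaches (compile c) (Suc (i * width + idx (ttrack p))) (St (Run K) (Ret ?b), tpos i (idx (ttrack p)) + 1, layout f' q w)
    (St (next_ctl K ?b) Start, -1, layout f' q w)"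
    using reaches_Ret[OF K, of c "i * width + idx (ttrack p)"] by metis
  note step = this
  show ?thesis
    by (rule reaches_micro[OF K, where t = "Suc (i * width + idx (ttrack p))" and v = MvR and m' = "Ret ?b"
          and x = "wsym p (bit_sym ?b)"])
      (use step m p upd idx_less[of "ttrack p"] in auto)
qed

text \<open>The way out and the way back each cross \<open>i\<close> blocks, whence
  \<open>2 * (i * width)\<close>; the other terms pay for the moves inside a block and for single
  turning steps.\<close>

lemma sim_walk:
  assumes K: "\<not> is_seq K" and p: "prim_of K = p" and g: "\<not> is_get p"
    and f: "\<And>k. k < i \<Longrightarrow> f (wtrack p) k" "\<not> f (wtrack p) i"
    and upd: "(layout (walked p f i) q w)(tpos i (idx (ttrack p)) :=
       wsym p (bit_sym (walked p f i (ttrack p) i))) = layout f' q w"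
  shows "reaches (compile c) (2 * (i * width) + 4 * width + 8) (St (Run K) Start, -1, layout f q w)
    (St (next_ctl K (walked p f i (ttrack p) i)) Start, -1, layout f' q w)"
proof -
  let ?j = "idx (wtrack p)" let ?k = "idx (ttrack p)"
  let ?f = "walked p f i"
  let ?end = "(St (next_ctl K (walked p f i (ttrack p) i)) Start, -1 :: int, layout f' q w)"
  have j: "?j < width" "?k < width" using idx_less by auto
  have nb: "\<not> ?f (wtrack p) i" using f by (auto simp: walked_def)
  have "reaches (compile c) (i * width + 2 * width + 6) (St (Run K) (Walk ?j), tpos i ?j, layout ?f q w) ?end"
  proof (cases "?j \<le> ?k")
    case True
    have "reaches (compile c) (?k - ?j) (St (Run K) (GoL (?k - ?j)), tpos i ?j, layout ?f q w)
      (St (Run K) (GoL 0), tpos i ?k, layout ?f q w)"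
      using reaches_GoL[OF K, of c "?k - ?j" i ?j] True by simp
    from reaches_trans[OF this reaches_act[OF K p _ g upd]]
    have "reaches (compile c) (i * width + 2 * width + 4) (St (Run K) (GoL (?k - ?j)), tpos i ?j, layout ?f q w) ?end"
      using j by simp
    note step = this
    show ?thesis
      by (rule reaches_micro[OF K, where t = "i * width + 2 * width + 4" and v = MvS and m' = "GoL (?k - ?j)"
          and x = "layout ?f q w (tpos i ?j)"]) (use step nb p True in \<open>auto simp: fun_upd_idem\<close>)
  next
    case False
    have "reaches (compile c) (?j - ?k) (St (Run K) (GoR (?j - ?k)), tpos i ?j, layout ?f q w)
      (St (Run K) (GoR 0), tpos i ?k, layout ?f q w)"
      using reaches_GoR[OF K, of c "?j - ?k" i ?k] False by simp
    from reaches_trans[OF this reaches_act[OF K p _ g upd]]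
    have "reaches (compile c) (i * width + 2 * width + 4) (St (Run K) (GoR (?j - ?k)), tpos i ?j, layout ?f q w) ?end"
      using j by simp
    note step = this
    show ?thesis
      by (rule reaches_micro[OF K, where t = "i * width + 2 * width + 4" and v = MvS and m' = "GoR (?j - ?k)"
          and x = "layout ?f q w (tpos i ?j)"]) (use step nb p False in \<open>auto simp: fun_upd_idem\<close>)
  qed
  moreover have "reaches (compile c) ?j (St (Run K) (Walk 0), tpos i 0, layout ?f q w)
     (St (Run K) (Walk ?j), tpos i ?j, layout ?f q w)"
    using reaches_Walk_skip[OF K, of ?j 0 c i] p j by auto
  ultimately have "reaches (compile c) (i * width + 3 * width + 6) (St (Run K) (Walk 0), tpos i 0, layout ?f q w) ?end"
    using reaches_trans j by fastforce
  with reaches_Walk[OF K p, of i f c q w] f(1)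
  have "reaches (compile c) (2 * (i * width) + 3 * width + 6) (St (Run K) (Walk 0), tpos 0 0, layout f q w) ?end"
    using reaches_trans by fastforce
  note step = this
  show ?thesis
    by (rule reaches_micro[OF K, where t = "2 * (i * width) + 3 * width + 6" and v = MvL and m' = "Walk 0" and x = Sep])
      (use step p g in \<open>auto simp: tpos_def fun_upd_idem\<close>)
qed

definition prim_cost :: nat where "prim_cost = 4 * width + 8"

lemma walk_cost: "i \<le> m \<Longrightarrow> 2 * (i * width) + 4 * width + 8 \<le> prim_cost * (m + 1)"
proof -
  assume "i \<le> m"
  then have "i * width \<le> m * width" by (rule mult_le_mono1)
  moreover have "prim_cost * (m + 1) = 4 * (m * width) + 4 * width + 8 * m + 8"
    by (simp add: prim_cost_def algebra_simps)
  ultimately show ?thesis by linarith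
qed

lemma sim_prim:
  assumes K: "\<not> is_seq K" and p: "prim_of K = p" and "pok p s" "Bl \<notin> set (inp s)"
    and m: "\<And>x. num s x \<le> m" "q \<le> m"
  shows "\<exists>q'\<le>Suc q. reaches (compile c) (prim_cost * (m + 1)) (St (Run K) Start, -1, htape s q)
    (St (next_ctl K (pres p s)) Start, -1, htape (peff p s) q')"
proof (cases "is_get p")
  case True
  then obtain b y where g: "p = Get b y" by (cases p) auto
  have "2 * q + 6 \<le> prim_cost * (m + 1)" using m(2) by (simp add: prim_cost_def algebra_simps)
  then show ?thesis using sim_get[OF K, of b y s c q] reaches_mono assms(3,4) g p
    by (intro exI[of _ "if b then Suc q else q"]) auto
next
  case False
  \<comment> \<open>The value of the followed register, which is the number of the block where the
    walk ends.\<close>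
  define i where "i = (case wtrack p of Num x \<Rightarrow> num s x | _ \<Rightarrow> 0)"
  have f: "tbits s (wtrack p) k \<longleftrightarrow> k < i" for k
    using False unfolding i_def by (cases p) (auto simp: tbits_def)
  have im: "i \<le> m" using m(1) unfolding i_def by (auto split: track.splits)
  have res: "walked p (tbits s) i (ttrack p) i = pres p s"
    using False unfolding i_def by (cases p) (auto simp: tbits_def walked_def)
  have inp: "inp (peff p s) = inp s" using False by (cases p) auto
  have upd: "(layout (walked p (tbits s) i) q (inp s))(tpos i (idx (ttrack p)) :=
       wsym p (bit_sym (walked p (tbits s) i (ttrack p) i))) = layout (tbits (peff p s)) q (inp s)"
  proof -
    \<comment> \<open>The bit left on the target track; a pure test writes back what it has read,
      and that is its result.\<close>
    define b where "b = (case p of Inc x \<Rightarrow> True | Zero x \<Rightarrow> False | Set a x b \<Rightarrow> b | _ \<Rightarrow> pres p s)"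
    have "wsym p (bit_sym (walked p (tbits s) i (ttrack p) i)) = bit_sym b"
      unfolding res b_def using False by (cases p) auto
    moreover have "(walked p (tbits s) i)(ttrack p := (walked p (tbits s) i (ttrack p))(i := b)) = tbits (peff p s)"
      unfolding i_def b_def using False
      by (cases p) (auto simp: tbits_def walked_def fun_eq_iff split: track.splits)
    ultimately show ?thesis using layout_update by metis
  qed
  have "reaches (compile c) (2 * (i * width) + 4 * width + 8) (St (Run K) Start, -1, htape s q)
    (St (next_ctl K (pres p s)) Start, -1, htape (peff p s) q)"
    using sim_walk[OF K p False, of i "tbits s" q "inp s" "tbits (peff p s)" c] f upd
    by (simp add: htape_def inp res)
  then show ?thesis using reaches_mono walk_cost[OF im] by (intro exI[of _ q]) auto
qed

section \<open>Simulating whole programs\<close>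

lemma peff_bounds:
  assumes "\<And>x. num s x \<le> m" "Bl \<notin> set (inp s)"
  shows "num (peff p s) x \<le> Suc m" "Bl \<notin> set (inp (peff p s))"
proof -
  show "num (peff p s) x \<le> Suc m" using assms(1)[of x] by (cases p) auto
  show "Bl \<notin> set (inp (peff p s))" using assms(2) by (cases p; cases "inp s") auto
qed

text \<open>One number \<open>m\<close> bounds all registers and the consumed part of the input, and
  each operation raises it by at most one. Carrying \<open>m\<close> as a parameter makes the bound
  compose: what holds after the first command is \<open>m + t\<close>, with which the second one
  starts.\<close>

lemma sim_exec:
  assumes "exec c s t s'" "Bl \<notin> set (inp s)" "\<And>x. num s x \<le> m" "q \<le> m"
  shows "\<exists>q'\<le>m + t. reaches (compile c0) (t * (prim_cost * (m + t))) (St (Run (c # K)) Start, -1, htape s q)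
    (St (Run K) Start, -1, htape s' q') \<and> Bl \<notin> set (inp s') \<and> (\<forall>x. num s' x \<le> m + t)"
  using assms
proof (induction arbitrary: m q K rule: exec.induct)
  case (Do p s)
  obtain q' where "q' \<le> Suc q" "reaches (compile c0) (prim_cost * (m + 1)) (St (Run (Do p # K)) Start, -1, htape s q)
    (St (Run K) Start, -1, htape (peff p s) q')"
    using sim_prim[of "Do p # K" p s m q c0] Do by auto
  then show ?case using peff_bounds[of s m p] Do by (intro exI[of _ q']) auto
next
  case (Seq c s t s1 d u s2)
  obtain q1 where q1: "q1 \<le> m + t" "reaches (compile c0) (t * (prim_cost * (m + t))) (St (Run (c # d # K)) Start, -1, htape s q)
    (St (Run (d # K)) Start, -1, htape s1 q1)" "Bl \<notin> set (inp s1)" "\<And>x. num s1 x \<le> m + t"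
    using Seq.IH(1)[of m q "d # K"] Seq.prems by blast
  obtain q2 where q2: "q2 \<le> m + t + u" "reaches (compile c0) (u * (prim_cost * (m + t + u))) (St (Run (d # K)) Start, -1, htape s1 q1)
    (St (Run K) Start, -1, htape s2 q2)" "Bl \<notin> set (inp s2)" "\<And>x. num s2 x \<le> m + t + u"
    using Seq.IH(2)[of "m + t" q1 K] q1 by blast
  \<comment> \<open>Both parts are charged the cost per operation that is valid at the end; the
    unfolding of the sequence is one more operation, of at most this cost.\<close>
  let ?B = "prim_cost * (m + t + u + 1)"
  have B: "1 \<le> ?B" "prim_cost * (m + t) \<le> ?B" "prim_cost * (m + t + u) \<le> ?B"
    by (simp_all add: prim_cost_def del: mult_Suc_right mult_le_cancel1)
  have "t * (prim_cost * (m + t)) + u * (prim_cost * (m + t + u)) \<le> t * ?B + u * ?B"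
    using mult_le_mono2[OF B(2), of t] mult_le_mono2[OF B(3), of u] by linarith
  then have "reaches (compile c0) (t * ?B + u * ?B) (St (Run (c # d # K)) Start, -1, htape s q)
    (St (Run K) Start, -1, htape s2 q2)"
    by (rule reaches_trans[OF q1(2) q2(2)])
  then have "reaches (compile c0) ((t + u + 1) * ?B) (St (Run ((c ;; d) # K)) Start, -1, htape s q)
    (St (Run K) Start, -1, htape s2 q2)"
    using B(1) by (intro reaches_step[of "compile c0" "St (Run ((c ;; d) # K)) Start" _ _ _ Sep MvS])
      (auto simp: fun_upd_idem htape_def algebra_simps)
  then show ?case using q2 by (intro exI[of _ q2]) (auto simp: algebra_simps intro: le_SucI)
next
  case (Ite p s c d t s2)
  obtain q1 where q1: "q1 \<le> Suc q" "reaches (compile c0) (prim_cost * (m + 1)) (St (Run (Ite p c d # K)) Start, -1, htape s q)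
    (St (Run ((if pres p s then c else d) # K)) Start, -1, htape (peff p s) q1)"
    using sim_prim[of "Ite p c d # K" p s m q c0] Ite by auto
  obtain q2 where q2: "q2 \<le> Suc m + t" "reaches (compile c0) (t * (prim_cost * (Suc m + t)))
      (St (Run ((if pres p s then c else d) # K)) Start, -1, htape (peff p s) q1)
      (St (Run K) Start, -1, htape s2 q2)" "Bl \<notin> set (inp s2)" "\<And>x. num s2 x \<le> Suc m + t"
    using Ite.IH[of "Suc m" q1 K] q1 Ite.prems peff_bounds[of s m p] by fastforce
  have "reaches (compile c0) ((t + 1) * (prim_cost * (m + (t + 1)))) (St (Run (Ite p c d # K)) Start, -1, htape s q)
    (St (Run K) Start, -1, htape s2 q2)"
    using q1(2) q2(2) by (rule reaches_trans) (simp add: algebra_simps)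
  then show ?case using q2 by (intro exI[of _ q2]) auto
next
  case (WhileF p s c)
  obtain q' where "q' \<le> Suc q" "reaches (compile c0) (prim_cost * (m + 1)) (St (Run (While p c # K)) Start, -1, htape s q)
    (St (Run K) Start, -1, htape (peff p s) q')"
    using sim_prim[of "While p c # K" p s m q c0] WhileF by auto
  then show ?case using peff_bounds[of s m p] WhileF by (intro exI[of _ q']) auto
next
  case (WhileT p s c t s1 u s2)
  obtain q0 where q0: "q0 \<le> Suc q" "reaches (compile c0) (prim_cost * (m + 1)) (St (Run (While p c # K)) Start, -1, htape s q)
    (St (Run (c # While p c # K)) Start, -1, htape (peff p s) q0)"
    using sim_prim[of "While p c # K" p s m q c0] WhileT by auto
  obtain q1 where q1: "q1 \<le> Suc m + t" "reaches (compile c0) (t * (prim_cost * (Suc m + t))) 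
    (St (Run (c # While p c # K)) Start, -1, htape (peff p s) q0)
    (St (Run (While p c # K)) Start, -1, htape s1 q1)" "Bl \<notin> set (inp s1)" "\<And>x. num s1 x \<le> Suc m + t"
    using WhileT.IH(1)[of "Suc m" q0 "While p c # K"] q0 WhileT.prems peff_bounds[of s m p] by fastforce
  obtain q2 where q2: "q2 \<le> Suc m + t + u" "reaches (compile c0) (u * (prim_cost * (Suc m + t + u))) (St (Run (While p c # K)) Start, -1, htape s1 q1)
    (St (Run K) Start, -1, htape s2 q2)" "Bl \<notin> set (inp s2)" "\<And>x. num s2 x \<le> Suc m + t + u"
    using WhileT.IH(2)[of "Suc m + t" q1 K] q1 by blast
  let ?B = "prim_cost * (m + (t + u + 1))"
  have B: "prim_cost * (m + 1) \<le> ?B" "prim_cost * (Suc m + t) \<le> ?B" "prim_cost * (Suc m + t + u) \<le> ?B" by auto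
  have "t * (prim_cost * (Suc m + t)) + u * (prim_cost * (Suc m + t + u)) \<le> t * ?B + u * ?B"
    using mult_le_mono2[OF B(2), of t] mult_le_mono2[OF B(3), of u] by linarith
  then have "reaches (compile c0) (t * ?B + u * ?B) (St (Run (c # While p c # K)) Start, -1, htape (peff p s) q0)
    (St (Run K) Start, -1, htape s2 q2)"
    by (rule reaches_trans[OF q1(2) q2(2)])
  with q0(2) have "reaches (compile c0) ((t + u + 1) * ?B) (St (Run (While p c # K)) Start, -1, htape s q)
    (St (Run K) Start, -1, htape s2 q2)"
    by (rule reaches_trans) (use B(1) in \<open>simp add: algebra_simps\<close>)
  then show ?case using q2 by (intro exI[of _ q2]) (auto simp: add.assoc)
qed

definition init_store :: "sym list \<Rightarrow> store" where
  "init_store w = \<lparr>num = (\<lambda>_. 0), arr = (\<lambda>_ _. False), inp = w @ [Sep]\<rparr>"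

lemma htape_init: "htape (init_store w) 0 = (tape_of w)(int (length w) := Sep, -1 := Sep)"
proof
  fix z
  have "tbits (init_store w) t i = False" for t i
    by (auto simp: tbits_def init_store_def split: track.splits)
  then show "htape (init_store w) 0 z = ((tape_of w)(int (length w) := Sep, -1 := Sep)) z"
    by (auto simp: htape_def layout_def tape_of_def init_store_def nth_default_append nth_default_def nth_Cons' nth_append
        split: if_splits) 
qed

lemma sim_init:
  assumes w: "Bl \<notin> set w"
  shows "reaches (compile c) (2 * length w + 4) (Init1, 0, tape_of w)
    (St (Run [c]) Start, -1, htape (init_store w) 0)"
proof -
  let ?n = "length w"
  define T where "T = (tape_of w)(int ?n := Sep)"
  have cell: "tape_of w (int k) \<noteq> Bl" if "k < ?n" for k
    using that w by (auto simp: tape_of_def nth_default_def in_set_conv_nth)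
  have right: "k \<le> ?n \<Longrightarrow> reaches (compile c) k (Init1, int (?n - k), tape_of w) (Init1, int ?n, tape_of w)" for k
  proof (induction k)
    case (Suc k)
    have "int (?n - Suc k) + 1 = int (?n - k)" using Suc.prems by simp
    then show ?case using Suc cell[of "?n - Suc k"]
      by (intro reaches_step[of "compile c" Init1 "tape_of w" _ Init1 _ MvR k]) auto
  qed (simp add: reaches_refl)
  have left: "k \<le> ?n \<Longrightarrow> reaches (compile c) k (Init2, int k - 1, T) (Init2, -1, T)" for k
  proof (induction k)
    case (Suc k)
    have "T (int k) = tape_of w (int k)" using Suc.prems by (simp add: T_def)
    moreover have "T(int k := tape_of w (int k)) = T" using Suc.prems by (intro ext) (simp add: T_def)
    ultimately show ?case using cell[of k] Suc
      by (intro reaches_step[of "compile c" Init2 T _ Init2 "tape_of w (int k)" MvL k]) simp_all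
  qed (simp add: reaches_refl)
  have "tape_of w (-1) = Bl" by (simp add: tape_of_def)
  then have "reaches (compile c) 1 (Init2, -1, T) (St (Run [c]) Start, -1, htape (init_store w) 0)"
    by (intro reaches_step[of "compile c" Init2 T _ _ Sep MvS 0]) (auto simp: T_def htape_init reaches_refl)
  with left[of ?n] have "reaches (compile c) (?n + 1) (Init2, int ?n - 1, T) (St (Run [c]) Start, -1, htape (init_store w) 0)"
    using reaches_trans by fastforce
  then have "reaches (compile c) (?n + 2) (Init1, int ?n, tape_of w) (St (Run [c]) Start, -1, htape (init_store w) 0)"
    by (intro reaches_step[of "compile c" Init1 "tape_of w" _ Init2 Sep MvL "?n + 1"])
      (auto simp: T_def tape_of_def nth_default_def)
  with right[of ?n] show ?thesis using reaches_trans by fastforce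
qed

text \<open>A position inside \<open>c\<close> determines the stack below it, because a loop body
  always runs on top of its own loop. So the continuations that can arise while \<open>c\<close>
  runs on \<open>K\<close> are finite in number although the stacks are lists.\<close>

fun conts :: "com \<Rightarrow> com list \<Rightarrow> com list set" where
  "conts (Do p) K = {Do p # K}"
| "conts (c ;; d) K = insert ((c ;; d) # K) (conts c (d # K) \<union> conts d K)"
| "conts (Ite p c d) K = insert (Ite p c d # K) (conts c K \<union> conts d K)"
| "conts (While p c) K = insert (While p c # K) (conts c (While p c # K))"

lemma finite_conts: "finite (conts c K)"
  by (induction c arbitrary: K) auto

lemma conts_self: "c # K \<in> conts c K"
  by (cases c) auto

lemma conts_closed: "K' \<in> conts c K \<Longrightarrow> next_ctl K' b \<in> Run ` insert K (conts c K)"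
proof (induction c arbitrary: K K')
  case (Seq c d)
  then show ?case using conts_self[of c "d # K"] conts_self[of d K] by fastforce
next
  case (Ite p c d)
  then show ?case using conts_self[of c K] conts_self[of d K] by fastforce
next
  case (While p c)
  then show ?case using conts_self[of c "While p c # K"] by fastforce
qed auto

definition micros :: "micro set" where
  "micros = {Start, Rt} \<union> Walk ` {..width} \<union> GoL ` {..width} \<union> GoR ` {..width} \<union> range Ret \<union> range Lf"

lemma micro_closed:
  assumes "m \<in> micros" "micro_delta p m s = (Inl m', x, v)"
  shows "m' \<in> micros"
proof -
  have "Suc j mod width \<le> width" for j using idx_less[of "Num rN"] by (simp add: order_less_imp_le)
  moreover have "idx t - j \<le> width" for t j using idx_less[of t] by simp
  ultimately show ?thesis using assms
    by (cases m) (auto simp: micros_def split: if_splits)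
qed

text \<open>One factor \<open>t + 1\<close> is the number of operations including the final test,
  the other the cost of each. The final tape is part of the conclusion for the sake of
  \<open>computable\<close>, which counts ones on it.\<close>

theorem compile_to_tm:
  "\<exists>M. wf_tm M \<and> (\<forall>w t s u. Bl \<notin> set w \<longrightarrow> exec c (init_store w) t s \<longrightarrow>
     2 * (2 * length w + 4 + prim_cost * (t + 1) * (t + 1)) \<le> u \<longrightarrow>
     (\<exists>l r q. run M u w = (if num s rZ < num s rR then 1 else 2, l, r) \<and> on_tape (-1) (htape s q) l r))"
proof -
  define C where "C = {Yes, No} \<union> Run ` insert [] (conts c [])"
  define Q where "Q = {Init1, Init2} \<union> (\<lambda>(x, m). St x m) ` (C \<times> micros)"
  have "finite Q" unfolding Q_def C_def micros_def using finite_conts by auto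
  have start: "Start \<in> micros" by (simp add: micros_def)
  have C_next: "next_ctl K b \<in> C" if "Run K \<in> C" for K b
    using that conts_closed[of K c "[]" b] unfolding C_def by auto
  have St_Q: "St x m \<in> Q" if "x \<in> C" "m \<in> micros" for x m using that unfolding Q_def by force
  have closed: "fst (compile c q s) \<in> Q" if "q \<in> Q" for q s
  proof (cases "\<exists>K m. q = St (Run K) m")
    case True
    then obtain K m where q: "q = St (Run K) m" by blast
    then have Km: "Run K \<in> C" "m \<in> micros" using that unfolding Q_def by auto
    obtain r x v where r: "micro_delta (prim_of K) m s = (r, x, v)" by (metis prod_cases3)
    show ?thesis using q Km C_next start micro_closed[OF Km(2)] r
      by (cases r) (auto intro!: St_Q)
  next
    case False
    have "Run [c] \<in> C" using conts_self[of c "[]"] by (simp add: C_def)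
    moreover have "q = Init1 \<or> q = Init2 \<or> (\<exists>m. q = St Yes m \<or> q = St No m)"
      using False by (cases q) (auto, metis ctl.exhaust)
    moreover have "Init1 \<in> Q" "Init2 \<in> Q" unfolding Q_def by auto
    ultimately show ?thesis using that start St_Q by auto
  qed
  have "Init1 \<in> Q" "St Yes Start \<in> Q" "St No Start \<in> Q" using start by (auto simp: Q_def C_def)
  then have "\<exists>M. wf_tm M \<and> (\<forall>w q p T t u. reaches (compile c) t (Init1, 0, tape_of w) (q, p, T) \<longrightarrow>
     q \<in> {St Yes Start, St No Start} \<longrightarrow> 2 * t \<le> u \<longrightarrow>
     (\<exists>l r. run M u w = (if q = St Yes Start then 1 else 2, l, r) \<and> on_tape p T l r))"
    by (rule machine_to_tm[OF \<open>finite Q\<close>]) (auto intro: closed)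
  then obtain M where M: "wf_tm M" "\<And>w q p T t u. reaches (compile c) t (Init1, 0, tape_of w) (q, p, T) \<Longrightarrow>
     q \<in> {St Yes Start, St No Start} \<Longrightarrow> 2 * t \<le> u \<Longrightarrow>
     \<exists>l r. run M u w = (if q = St Yes Start then 1 else 2, l, r) \<and> on_tape p T l r"
    by blast
  have "\<exists>l r q. run M u w = (if num s rZ < num s rR then 1 else 2, l, r) \<and> on_tape (-1) (htape s q) l r"
    if w: "Bl \<notin> set w" and ex: "exec c (init_store w) t s"
      and u: "2 * (2 * length w + 4 + prim_cost * (t + 1) * (t + 1)) \<le> u" for w t s u
  proof -
    have i: "Bl \<notin> set (inp (init_store w))" "num (init_store w) x \<le> 0" for x
      using w by (auto simp: init_store_def)
    obtain q where q: "q \<le> t" "reaches (compile c) (t * (prim_cost * t)) (St (Run [c]) Start, -1, htape (init_store w) 0)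
      (St (Run []) Start, -1, htape s q)" "Bl \<notin> set (inp s)" "\<And>x. num s x \<le> t"
      using sim_exec[OF ex i, of 0 c "[]"] by auto
    let ?q = "St (if num s rZ < num s rR then Yes else No) Start"
    obtain q' where q': "reaches (compile c) (prim_cost * (t + 1)) (St (Run []) Start, -1, htape s q)
      (?q, -1, htape s q')"
      using sim_prim[of "[]" "Lt rZ rR" s t q c] q by auto
    have "reaches (compile c) (t * (prim_cost * t) + prim_cost * (t + 1)) (St (Run [c]) Start, -1, htape (init_store w) 0)
       (?q, -1, htape s q')"
      using reaches_trans[OF q(2) q'] by simp
    from reaches_trans[OF sim_init[OF w] this]
    have "reaches (compile c) (2 * length w + 4 + prim_cost * (t + 1) * (t + 1)) (Init1, 0, tape_of w) (?q, -1, htape s q')"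
      by (simp add: algebra_simps)
    from M(2)[OF this _ u] show ?thesis by (cases "num s rZ < num s rR") auto
  qed
  then show ?thesis using M(1) by blast
qed

section \<open>Reasoning about programs\<close>

text \<open>Total correctness within a time budget. For straight-line code and conditionals the simp
  rules below evaluate it symbolically; loops go through \<open>ok_for\<close>.\<close>

definition ok :: "com \<Rightarrow> store \<Rightarrow> nat \<Rightarrow> (store \<Rightarrow> bool) \<Rightarrow> bool" where
  "ok c s T Q \<longleftrightarrow> (\<exists>t s'. exec c s t s' \<and> t \<le> T \<and> Q s')"

inductive_cases exec_DoE: "exec (Do p) s t s'"
inductive_cases exec_SeqE: "exec (c ;; d) s t s'"
inductive_cases exec_IteE: "exec (Ite p c d) s t s'"

lemma ok_Do [simp]: "ok (Do p) s T Q \<longleftrightarrow> pok p s \<and> 1 \<le> T \<and> Q (peff p s)"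
  unfolding ok_def using exec.Do by (auto elim!: exec_DoE) 

lemma ok_Ite [simp]:
  "ok (Ite p c d) s T Q \<longleftrightarrow> pok p s \<and> 1 \<le> T \<and> ok (if pres p s then c else d) (peff p s) (T - 1) Q"
proof
  assume "ok (Ite p c d) s T Q"
  then show "pok p s \<and> 1 \<le> T \<and> ok (if pres p s then c else d) (peff p s) (T - 1) Q"
    unfolding ok_def by (auto elim!: exec_IteE) (fastforce)+
next
  assume *: "pok p s \<and> 1 \<le> T \<and> ok (if pres p s then c else d) (peff p s) (T - 1) Q"
  then obtain t s' where t: "exec (if pres p s then c else d) (peff p s) t s'" "t \<le> T - 1" "Q s'"
    unfolding ok_def by blast
  then show "ok (Ite p c d) s T Q" unfolding ok_def using exec.Ite[OF _ t(1)] *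
    by (intro exI[of _ "t + 1"]) auto
qed

lemma ok_Seq_iff: "ok (c ;; d) s T Q \<longleftrightarrow>
  (\<exists>t u s1 s2. exec c s t s1 \<and> exec d s1 u s2 \<and> t + u + 1 \<le> T \<and> Q s2)"
proof
  assume "ok (c ;; d) s T Q"
  then show "\<exists>t u s1 s2. exec c s t s1 \<and> exec d s1 u s2 \<and> t + u + 1 \<le> T \<and> Q s2"
    unfolding ok_def by (elim exE conjE exec_SeqE) (use Suc_eq_plus1 in metis)
next
  assume "\<exists>t u s1 s2. exec c s t s1 \<and> exec d s1 u s2 \<and> t + u + 1 \<le> T \<and> Q s2"
  then show "ok (c ;; d) s T Q" unfolding ok_def using exec.Seq by blast
qed

text \<open>Both nestings pay for two sequences. The rule brings the first primitive to the front
  once \<open>ok_Seq_Ite\<close> has pushed the rest of a program behind a branch that is itself a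
  sequence.\<close>

lemma ok_Seq_assoc [simp]: "ok ((a ;; b) ;; c) s T Q = ok (a ;; (b ;; c)) s T Q"
proof
  assume "ok ((a ;; b) ;; c) s T Q"
  then obtain t u v s1 s2 s3 where *: "exec a s t s1" "exec b s1 u s2" "exec c s2 v s3"
    "t + u + 1 + v + 1 \<le> T" "Q s3" unfolding ok_Seq_iff by (auto elim!: exec_SeqE)
  with exec.Seq[OF *(2,3)] show "ok (a ;; (b ;; c)) s T Q"
    unfolding ok_Seq_iff by (intro exI[of _ t] exI[of _ "u + v + 1"]) auto
next
  assume "ok (a ;; (b ;; c)) s T Q"
  then obtain t u v s1 s2 s3 where *: "exec a s t s1" "exec b s1 u s2" "exec c s2 v s3"
    "t + (u + v + 1) + 1 \<le> T" "Q s3" unfolding ok_Seq_iff by (auto elim!: exec_SeqE)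
  with exec.Seq[OF *(1,2)] show "ok ((a ;; b) ;; c) s T Q"
    unfolding ok_Seq_iff by (intro exI[of _ "t + u + 1"] exI[of _ v]) auto
qed

lemma ok_Seq_Do [simp]: "ok (Do p ;; d) s T Q \<longleftrightarrow> pok p s \<and> 2 \<le> T \<and> ok d (peff p s) (T - 2) Q"
proof
  assume "ok (Do p ;; d) s T Q"
  then show "pok p s \<and> 2 \<le> T \<and> ok d (peff p s) (T - 2) Q"
    unfolding ok_def by (auto elim!: exec_SeqE exec_DoE) fastforce
next
  assume *: "pok p s \<and> 2 \<le> T \<and> ok d (peff p s) (T - 2) Q"
  then obtain t s' where t: "exec d (peff p s) t s'" "t \<le> T - 2" "Q s'"
    unfolding ok_def by blast
  then show "ok (Do p ;; d) s T Q" unfolding ok_def using exec.Seq[OF exec.Do t(1)] *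
    by (intro exI[of _ "1 + t + 1"]) auto
qed

lemma ok_Seq_Ite [simp]:
  "ok (Ite p c e ;; d) s T Q \<longleftrightarrow>
   pok p s \<and> 1 \<le> T \<and> ok ((if pres p s then c else e) ;; d) (peff p s) (T - 1) Q"
proof
  assume "ok (Ite p c e ;; d) s T Q"
  then obtain t u s1 s2 where *: "pok p s" "exec (if pres p s then c else e) (peff p s) t s1"
    "exec d s1 u s2" "t + 1 + u + 1 \<le> T" "Q s2"
    unfolding ok_Seq_iff by (auto elim!: exec_IteE)
  then have "t + u + 1 \<le> T - 1" by simp
  with * show "pok p s \<and> 1 \<le> T \<and> ok ((if pres p s then c else e) ;; d) (peff p s) (T - 1) Q"
    unfolding ok_Seq_iff by (metis add_leE le_add2 order_trans)
next
  assume *: "pok p s \<and> 1 \<le> T \<and> ok ((if pres p s then c else e) ;; d) (peff p s) (T - 1) Q"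
  then obtain t u s1 s2 where **: "exec (if pres p s then c else e) (peff p s) t s1"
    "exec d s1 u s2" "t + u + 1 \<le> T - 1" "Q s2"
    unfolding ok_Seq_iff by auto
  have "exec (Ite p c e) s (t + 1) s1" "t + 1 + u + 1 \<le> T" using exec.Ite[OF _ **(1)] * **(3) by auto
  with ** show "ok (Ite p c e ;; d) s T Q" unfolding ok_Seq_iff by blast
qed

lemma ok_mono: "ok c s T P \<Longrightarrow> (\<And>s'. P s' \<Longrightarrow> Q s') \<Longrightarrow> T \<le> U \<Longrightarrow> ok c s U Q"
  unfolding ok_def by (meson order_trans)

lemma ok_time: "ok c s T Q \<Longrightarrow> T \<le> U \<Longrightarrow> ok c s U Q"
  by (rule ok_mono)

fun prim_regs :: "prim \<Rightarrow> reg set" where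
  "prim_regs (Inc x) = {x}" | "prim_regs (Zero x) = {x}" | "prim_regs _ = {}"

fun prim_arrs :: "prim \<Rightarrow> ary set" where
  "prim_arrs (Set a x b) = {a}" | "prim_arrs _ = {}"

fun prim_reads :: "prim \<Rightarrow> bool" where
  "prim_reads (Get c y) = c" | "prim_reads _ = False"

fun regs :: "com \<Rightarrow> reg set" where
  "regs (Do p) = prim_regs p" | "regs (c ;; d) = regs c \<union> regs d"
| "regs (Ite p c d) = prim_regs p \<union> regs c \<union> regs d" | "regs (While p c) = prim_regs p \<union> regs c"

fun arrs :: "com \<Rightarrow> ary set" where
  "arrs (Do p) = prim_arrs p" | "arrs (c ;; d) = arrs c \<union> arrs d"
| "arrs (Ite p c d) = prim_arrs p \<union> arrs c \<union> arrs d" | "arrs (While p c) = prim_arrs p \<union> arrs c"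

fun reads :: "com \<Rightarrow> bool" where
  "reads (Do p) = prim_reads p" | "reads (c ;; d) = (reads c \<or> reads d)"
| "reads (Ite p c d) = (prim_reads p \<or> reads c \<or> reads d)" | "reads (While p c) = (prim_reads p \<or> reads c)"

text \<open>What the syntax alone shows to be unchanged. The rules for sequences and loops hand it
  out for free, so that specifications and invariants mention only what is modified.\<close>

definition frame :: "com \<Rightarrow> store \<Rightarrow> store \<Rightarrow> bool" where
  "frame c s s' \<longleftrightarrow> (\<forall>x. x \<notin> regs c \<longrightarrow> num s' x = num s x) \<and>
     (\<forall>a. a \<notin> arrs c \<longrightarrow> arr s' a = arr s a) \<and> (\<not> reads c \<longrightarrow> inp s' = inp s)"

lemma frame_prim: "(x \<notin> prim_regs p \<longrightarrow> num (peff p s) x = num s x) \<and>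
  (a \<notin> prim_arrs p \<longrightarrow> arr (peff p s) a = arr s a) \<and> (\<not> prim_reads p \<longrightarrow> inp (peff p s) = inp s)"
  by (cases p) auto

lemma exec_frame: "exec c s t s' \<Longrightarrow> frame c s s'"
  unfolding frame_def by (induction rule: exec.induct) (use frame_prim in \<open>auto split: if_splits\<close>)

lemma ok_frame: "ok c s T Q \<Longrightarrow> ok c s T (\<lambda>s'. Q s' \<and> frame c s s')"
  unfolding ok_def using exec_frame by blast

lemma ok_Seq:
  assumes "ok c s T P" "\<And>s'. P s' \<Longrightarrow> frame c s s' \<Longrightarrow> ok d s' U Q" "T + U + 1 \<le> V"
  shows "ok (c ;; d) s V Q"
proof -
  obtain t s1 where t: "exec c s t s1" "t \<le> T" "P s1" using assms(1) unfolding ok_def by blast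
  then obtain u s2 where u: "exec d s1 u s2" "u \<le> U" "Q s2"
    using assms(2) exec_frame unfolding ok_def by blast
  with t assms(3) show ?thesis unfolding ok_Seq_iff
    by (intro exI[of _ t] exI[of _ u] exI[of _ s1] exI[of _ s2]) auto
qed

lemma frame_While_prim: "frame (While p c) s s' \<Longrightarrow> frame (While p c) s (peff p s')"
  using frame_prim[of _ p s'] unfolding frame_def by auto

lemma frame_While_body: "frame (While p c) s s' \<Longrightarrow> frame c s' s'' \<Longrightarrow> frame (While p c) s s''"
  unfolding frame_def by auto

text \<open>The number \<open>n\<close> of rounds is fixed in advance and the invariant is indexed
  by the round, which settles termination and time together: each round costs its body and one test,
  and one last test fails. The invariant describes the state before the test, whose effect
  \<open>peff p\<close> is then applied.\<close>

lemma ok_for: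
  assumes init: "I 0 s"
    and body: "\<And>i s'. i < n \<Longrightarrow> I i s' \<Longrightarrow> frame (While p c) s s' \<Longrightarrow>
      pok p s' \<and> pres p s' \<and> ok c (peff p s') T (I (Suc i))"
    and exit: "\<And>s'. I n s' \<Longrightarrow> frame (While p c) s s' \<Longrightarrow> pok p s' \<and> \<not> pres p s' \<and> Q (peff p s')"
    and U: "n * (T + 1) + 1 \<le> U"
  shows "ok (While p c) s U Q"
proof -
  \<comment> \<open>Induction on the number \<open>d\<close> of rounds still to come.\<close>
  have "d \<le> n \<Longrightarrow> I (n - d) s' \<Longrightarrow> frame (While p c) s s' \<Longrightarrow> ok (While p c) s' (d * (T + 1) + 1) Q" for d s'
  proof (induction d arbitrary: s')
    case 0
    then show ?case using exec.WhileF[of p s' c] exit[of s'] unfolding ok_def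
      by (intro exI[of _ 1] exI[of _ "peff p s'"]) auto
  next
    case (Suc d)
    let ?i = "n - Suc d"
    have i: "?i < n" "Suc ?i = n - d" using Suc.prems by auto
    from body[OF i(1) Suc.prems(2,3)] obtain t s1 where
      t: "pok p s'" "pres p s'" "exec c (peff p s') t s1" "t \<le> T" "I (n - d) s1"
      unfolding ok_def i(2) by blast
    have "frame (While p c) s s1"
      using frame_While_body[OF frame_While_prim[OF Suc.prems(3)] exec_frame[OF t(3)]] .
    from Suc.IH[OF _ t(5) this] Suc.prems obtain u s2 where
      u: "exec (While p c) s1 u s2" "u \<le> d * (T + 1) + 1" "Q s2" unfolding ok_def by auto
    then show ?case using exec.WhileT[OF t(1-3) u(1)] t(4) unfolding ok_def
      by (intro exI[of _ "t + u + 1"] exI[of _ s2]) auto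
  qed
  from this[of n s] init show ?thesis using ok_mono[OF _ _ U] by (simp add: frame_def)
qed

section \<open>Reading the instance\<close>

abbreviation skip :: com where "skip \<equiv> Do (Lt rZ rZ)"

definition copy :: "reg \<Rightarrow> reg \<Rightarrow> com" where
  "copy x y = Do (Zero x) ;; While (Lt x y) (Do (Inc x))"

lemma copy_frame [simp]: "regs (copy x y) = {x}" "arrs (copy x y) = {}" "reads (copy x y) = False"
  by (auto simp: copy_def)

lemma ok_copy:
  assumes "x \<noteq> y" "2 * num s y + 3 \<le> T"
  shows "ok (copy x y) s T (\<lambda>s'. s' = s\<lparr>num := (num s)(x := num s y)\<rparr>)"
proof -
  have "ok (While (Lt x y) (Do (Inc x))) (peff (Zero x) s) (2 * num s y + 1)
    (\<lambda>s'. s' = s\<lparr>num := (num s)(x := num s y)\<rparr>)"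
    by (rule ok_for[where I = "\<lambda>i s'. s' = s\<lparr>num := (num s)(x := i)\<rparr>" and n = "num s y" and T = 1])
      (use assms in auto)
  then have "ok (copy x y) s (2 * num s y + 3) (\<lambda>s'. s' = s\<lparr>num := (num s)(x := num s y)\<rparr>)"
    by (simp add: copy_def)
  then show ?thesis by (rule ok_mono) (use assms in auto)
qed

text \<open>Sums are capped at \<open>rN\<close>: the input \<open>k\<close> is given in binary, and its unary value could be exponentially
  long. Nothing is lost, since every vertex cover has at most \<open>n\<close> vertices.\<close>

definition addcap :: "reg \<Rightarrow> reg \<Rightarrow> com" where
  "addcap x y = copy rU y ;; Do (Zero rT) ;;
     While (Lt rT rU) (Do (Inc rT) ;; Ite (Lt x rN) (Do (Inc x)) skip)"

lemma addcap_frame [simp]: "regs (addcap x y) = {rU, rT, x}" "arrs (addcap x y) = {}" "reads (addcap x y) = False"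
  by (auto simp: addcap_def)

text \<open>The summand is first copied to \<open>rU\<close>, so \<open>x = y\<close> is admissible;
  this is how \<open>rQ\<close> gets doubled.\<close>

lemma ok_addcap:
  assumes xy: "x \<notin> {rU, rT, rN}" "y \<notin> {rU, rT}" and le: "num s x \<le> num s rN"
    and T: "7 * num s y + 10 \<le> T"
  shows "ok (addcap x y) s T (\<lambda>s'. num s' x = min (num s rN) (num s x + num s y))"
proof -
  let ?s = "s\<lparr>num := (num s)(rU := num s y)\<rparr>"
  have "ok (While (Lt rT rU) (Do (Inc rT) ;; Ite (Lt x rN) (Do (Inc x)) skip)) (peff (Zero rT) ?s) (5 * num s y + 1)
    (\<lambda>s'. num s' x = min (num s rN) (num s x + num s y))"
    by (rule ok_for[where I = "\<lambda>i s'. num s' rT = i \<and> num s' x = min (num s rN) (num s x + i)"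
          and n = "num s y" and T = 4])
      (use xy le in \<open>auto simp: frame_def\<close>)
  then have *: "ok (Do (Zero rT) ;; While (Lt rT rU) (Do (Inc rT) ;; Ite (Lt x rN) (Do (Inc x)) skip)) ?s (5 * num s y + 3)
    (\<lambda>s'. num s' x = min (num s rN) (num s x + num s y))" by simp
  show ?thesis unfolding addcap_def
    by (rule ok_Seq[OF ok_copy[OF _ order_refl], where U = "5 * num s y + 3"]) (use xy T * in auto)
qed

definition read_n :: com where
  "read_n = While (Get True Sep) (Do (Inc rN))"

lemma ok_read_n:
  assumes "num s rN = 0" "inp s = replicate n B1 @ Sep # w" "2 * n + 1 \<le> T"
  shows "ok read_n s T (\<lambda>s'. num s' rN = n \<and> inp s' = w)"
  unfolding read_n_def
  by (rule ok_for[where I = "\<lambda>i s'. num s' rN = i \<and> inp s' = replicate (n - i) B1 @ Sep # w" and n = n and T = 1])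
    (use assms in \<open>auto simp: Suc_diff_Suc[symmetric]\<close>)

text \<open>The loop test only peeks, since the same symbol must be examined again;
  \<open>Get True B0\<close> then consumes it and succeeds exactly on \<open>B1\<close>.\<close>

definition read_matrix :: com where
  "read_matrix = While (Get False Sep) (Ite (Get True B0) (Do (Set aG rP True)) skip ;; Do (Inc rP)) ;;
     Do (Get True Sep)"

lemma ok_read_matrix:
  assumes "num s rP = 0" "arr s aG = (\<lambda>_. False)" "inp s = bs @ Sep # w" "set bs \<subseteq> {B0, B1}"
    "6 * length bs + 5 \<le> T"
  shows "ok read_matrix s T (\<lambda>s'. num s' rP = length bs \<and> inp s' = w \<and>
    arr s' aG = (\<lambda>i. i < length bs \<and> bs ! i = B1))"
proof -
  have "ok (While (Get False Sep) (Ite (Get True B0) (Do (Set aG rP True)) skip ;; Do (Inc rP))) s (6 * length bs + 1)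
    (\<lambda>s'. num s' rP = length bs \<and> inp s' = Sep # w \<and> arr s' aG = (\<lambda>i. i < length bs \<and> bs ! i = B1))"
  proof (rule ok_for[where I = "\<lambda>k s'. num s' rP = k \<and> inp s' = drop k bs @ Sep # w \<and>
      arr s' aG = (\<lambda>i. i < k \<and> bs ! i = B1)" and n = "length bs" and T = 5], goal_cases)
    case (2 k s')
    then have *: "drop k bs = bs ! k # drop (Suc k) bs" "bs ! k = B0 \<or> bs ! k = B1"
      using assms(4) by (auto simp: Cons_nth_drop_Suc dest: nth_mem)
    have "(\<lambda>i. i < k \<and> bs ! i = B1)(k := True) = (\<lambda>i. i < Suc k \<and> bs ! i = B1)" if "bs ! k = B1"
      using that by (intro ext) (auto simp: less_Suc_eq)
    moreover have "(\<lambda>i. i < k \<and> bs ! i = B1) = (\<lambda>i. i < Suc k \<and> bs ! i = B1)" if "bs ! k = B0"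
      using that by (auto simp: less_Suc_eq)
    ultimately show ?case using 2(2) * by auto
  qed (use assms in auto)
  then show ?thesis unfolding read_matrix_def
    by (rule ok_Seq[where U = 1]) (use assms in auto)
qed

fun bin_val :: "sym list \<Rightarrow> nat" where
  "bin_val [] = 0" | "bin_val (b # bs) = (if b = B1 then 1 else 0) + 2 * bin_val bs"

lemma bin_val_bin: "bin_val (bin k) = k"
proof (induction k rule: bin.induct)
  case (1 k)
  show ?case
  proof (cases "k = 0")
    case False
    then show ?thesis using 1 by (subst bin.simps) (auto simp del: bin.simps, presburger+)
  qed simp
qed

lemma set_bin: "set (bin k) \<subseteq> {B0, B1}"
proof (induction k rule: bin.induct)
  case (1 k)
  then show ?case by (subst bin.simps) (auto simp del: bin.simps)
qed

text \<open>\<open>bin\<close> lists the low bits first, so \<open>rQ\<close> runs through the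
  powers of two. It starts with 1, capped at \<open>n\<close>, which is 0 for the empty
  graph.\<close>

definition read_k :: com where
  "read_k = Ite (Lt rQ rN) (Do (Inc rQ)) skip ;;
     While (Get False Sep) (Ite (Get True B0) (addcap rK rQ) skip ;; addcap rQ rQ)"

lemma bin_val_append: "bin_val (as @ bs) = bin_val as + 2 ^ length as * bin_val bs"
  by (induction as) auto

text \<open>Capping both summands does not change the capped sum; hence capping after every addition
  gives the same as capping the final value.\<close>

lemma min_add_cap: "min (n::nat) (min n a + min n b) = min n (a + b)" by auto

lemma ok_read_k:
  assumes "num s rQ = 0" "num s rK = 0" "inp s = bs @ [Sep]" "set bs \<subseteq> {B0, B1}"
    and T: "length bs * (14 * num s rN + 24) + 10 \<le> T"
  shows "ok read_k s T (\<lambda>s'. num s' rK = min (num s rN) (bin_val bs))"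
proof -
  let ?n = "num s rN"
  have "ok (While (Get False Sep) (Ite (Get True B0) (addcap rK rQ) skip ;; addcap rQ rQ))
    (if rQ = rQ \<and> num s rQ < num s rN then peff (Inc rQ) s else s) (length bs * (14 * num s rN + 24) + 1)
    (\<lambda>s'. num s' rK = min ?n (bin_val bs))" (is "ok _ ?s _ _")
  proof (rule ok_for[where I = "\<lambda>i s'. num s' rQ = min ?n (2 ^ i) \<and> num s' rK = min ?n (bin_val (take i bs)) \<and>
      inp s' = drop i bs @ [Sep]" and n = "length bs" and T = "14 * ?n + 23"], goal_cases)
    case (2 i s')
    then have *: "drop i bs = bs ! i # drop (Suc i) bs" "bs ! i = B0 \<or> bs ! i = B1"
      using assms(4) by (auto simp: Cons_nth_drop_Suc dest: nth_mem)
    have N: "num s' rN = ?n" using 2(3) by (auto simp: frame_def split: if_splits)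
    have bv: "bin_val (take (Suc i) bs) = bin_val (take i bs) + (if bs ! i = B1 then 2 ^ i else 0)"
      using 2(1) by (simp add: take_Suc_conv_app_nth bin_val_append min_def)
    have dbl: "ok (addcap rQ rQ) s1 (7 * ?n + 10) (\<lambda>s2. num s2 rQ = min ?n (2 ^ Suc i) \<and>
        num s2 rK = min ?n (bin_val (take (Suc i) bs)) \<and> inp s2 = drop (Suc i) bs @ [Sep])"
      if "num s1 rN = ?n" "num s1 rQ = min ?n (2 ^ i)" "num s1 rK = min ?n (bin_val (take (Suc i) bs))"
        "inp s1 = drop (Suc i) bs @ [Sep]" for s1
      by (rule ok_mono[OF ok_frame[OF ok_addcap[OF _ _ _ order_refl]], where U = "7 * ?n + 10"])
        (use that in \<open>auto simp: frame_def min_add_cap mult_2\<close>)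
    let ?s1 = "s'\<lparr>inp := drop (Suc i) bs @ [Sep]\<rparr>"
    have "ok ((if bs ! i \<noteq> B0 then addcap rK rQ else skip) ;; addcap rQ rQ) ?s1 (14 * ?n + 22)
       (\<lambda>s2. num s2 rQ = min ?n (2 ^ Suc i) \<and>
        num s2 rK = min ?n (bin_val (take (Suc i) bs)) \<and> inp s2 = drop (Suc i) bs @ [Sep])"
    proof (cases "bs ! i = B0")
      case True
      then show ?thesis using ok_mono[OF dbl[of ?s1]] 2(2) N bv by simp
    next
      case False
      then have "ok (addcap rK rQ ;; addcap rQ rQ) ?s1 (14 * ?n + 22)
       (\<lambda>s2. num s2 rQ = min ?n (2 ^ Suc i) \<and>
        num s2 rK = min ?n (bin_val (take (Suc i) bs)) \<and> inp s2 = drop (Suc i) bs @ [Sep])"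
        by (intro ok_Seq[OF ok_addcap[OF _ _ _ order_refl] dbl])
          (use 2(2) N bv * in \<open>auto simp: frame_def min_add_cap\<close>)
      then show ?thesis using False by simp
    qed
    then show ?case using 2(2) * by (auto simp: add.commute)
  qed (use assms in \<open>auto simp: frame_def split: if_splits\<close>)
  note loop = this
  show ?thesis
    unfolding read_k_def by (rule ok_Seq[where T = 3 and P = "\<lambda>s'. s' = ?s" 
          and U = "length bs * (14 * num s rN + 24) + 1"])
      (use loop T in auto)
qed

section \<open>The threshold for high degrees\<close>

definition row :: "(nat \<Rightarrow> bool) \<Rightarrow> nat \<Rightarrow> nat \<Rightarrow> nat set" where
  "row g n i = {j. j < n \<and> g (i * n + j)}"

lemma card_less_Suc_Collect:
  "card {j. j < Suc i \<and> P j} = card {j. j < i \<and> P j} + of_bool (P i)"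
proof -
  have "{j. j < Suc i \<and> P j} = (if P i then insert i {j. j < i \<and> P j} else {j. j < i \<and> P j})"
    by (auto simp: less_Suc_eq)
  then show ?thesis by simp
qed

definition count_row :: com where
  "count_row = While (Lt rJ rN) (Ite (Bit aG rQ) (Do (Inc rD)) skip ;; Do (Inc rQ) ;; Do (Inc rJ))"

lemma ok_count_row:
  assumes "num s rJ = 0" "num s rQ = i * num s rN" "7 * num s rN + 1 \<le> T"
  shows "ok count_row s T (\<lambda>s'. num s' rD = num s rD + card (row (arr s aG) (num s rN) i) \<and>
    num s' rQ = Suc i * num s rN)"
  unfolding count_row_def
  by (rule ok_for[where I = "\<lambda>j s'. num s' rJ = j \<and> num s' rQ = i * num s rN + j \<and>
      num s' rD = num s rD + card {j'. j' < j \<and> arr s aG (i * num s rN + j')}" and n = "num s rN" and T = 6])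
    (use assms in \<open>auto simp: frame_def row_def card_less_Suc_Collect\<close>)

text \<open>The set of vertices of high degree is stored as an additional row \<open>n\<close> of the adjacency matrix, so that
  all starting sets of the search are rows.\<close>

definition high_body :: com where
  "high_body = copy rD rL ;; Do (Zero rJ) ;; count_row ;;
     Ite (Lt rD rK) (Do (Set aG rW False)) (Do (Set aG rW True) ;; Do (Inc rE)) ;; Do (Inc rW) ;; Do (Inc rI)"

text \<open>Degree at least \<open>k - l\<close>, written without truncated subtraction; for the
  same reason \<open>high_body\<close> starts its degree counter at \<open>l\<close>.\<close>

definition high :: "(nat \<Rightarrow> bool) \<Rightarrow> nat \<Rightarrow> nat \<Rightarrow> nat \<Rightarrow> nat set" where
  "high g n k l = {i. i < n \<and> k \<le> card (row g n i) + l}"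

lemma count_row_frame [simp]: "regs count_row = {rD, rQ, rJ}" "arrs count_row = {}" "reads count_row = False"
  by (auto simp: count_row_def)

lemma ok_high_body:
  assumes "num s rI = i" "num s rQ = i * num s rN" "2 * num s rL + 7 * num s rN + 20 \<le> T"
  shows "ok high_body s T (\<lambda>s'. num s' rI = Suc i \<and> num s' rQ = Suc i * num s rN \<and> num s' rW = Suc (num s rW) \<and>
    num s' rE = num s rE + of_bool (num s rK \<le> card (row (arr s aG) (num s rN) i) + num s rL) \<and>
    arr s' aG = (arr s aG)(num s rW := num s rK \<le> card (row (arr s aG) (num s rN) i) + num s rL))"
  unfolding high_body_def
proof (rule ok_Seq[OF ok_copy[OF _ order_refl], where U = "7 * num s rN + 16"], goal_cases)
  case (2 s1)
  have "ok (count_row ;; Ite (Lt rD rK) (Do (Set aG rW False)) (Do (Set aG rW True) ;; Do (Inc rE)) ;; Do (Inc rW) ;; Do (Inc rI))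
    (peff (Zero rJ) s1) (7 * num s rN + 14)
    (\<lambda>s'. num s' rI = Suc i \<and> num s' rQ = Suc i * num s rN \<and> num s' rW = Suc (num s rW) \<and>
    num s' rE = num s rE + of_bool (num s rK \<le> card (row (arr s aG) (num s rN) i) + num s rL) \<and>
    arr s' aG = (arr s aG)(num s rW := num s rK \<le> card (row (arr s aG) (num s rN) i) + num s rL))"
    by (rule ok_Seq[OF ok_count_row[OF _ _ order_refl], where U = 12])
      (use assms 2 in \<open>auto simp: frame_def add.commute\<close>)
  then show ?case using 2 by (simp add: add.commute)
qed (use assms in auto)

lemma high_body_frame [simp]: "regs high_body = {rD, rJ, rQ, rE, rW, rI}" "arrs high_body = {aG}" "reads high_body = False"
  by (auto simp: high_body_def)

text \<open>\<open>rE\<close> starts at \<open>l\<close>, so that its comparison with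
  \<open>rK\<close> decides whether enough vertices qualify; \<open>rW\<close> starts at
  \<open>rP = n * n\<close>, the first position of row \<open>n\<close>.\<close>

definition high_row :: com where
  "high_row = copy rE rL ;; copy rW rP ;; Do (Zero rQ) ;; Do (Zero rI) ;; While (Lt rI rN) high_body"

lemma high_row_frame [simp]: "regs high_row = {rD, rJ, rQ, rE, rW, rI}" "arrs high_row = {aG}" "reads high_row = False"
  by (auto simp: high_row_def)

text \<open>Every round of the threshold loop overwrites row \<open>n\<close>. The rows of vertices
  lie below position \<open>n * n\<close> and survive.\<close>

lemma row_cong: "(\<And>p. p < n * n \<Longrightarrow> g p = h p) \<Longrightarrow> i < n \<Longrightarrow> row g n i = row h n i"
proof -
  assume *: "\<And>p. p < n * n \<Longrightarrow> g p = h p" and i: "i < n"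
  have "i * n + j < n * n" if "j < n" for j
  proof -
    have "i * n + j < Suc i * n" using that by simp
    also have "\<dots> \<le> n * n" using i by (intro mult_le_mono1) simp
    finally show ?thesis .
  qed
  then show ?thesis using * by (auto simp: row_def)
qed

lemma ok_high_row:
  assumes N: "num s rN = n" and P: "num s rP = n * n" and T: "n * (2 * num s rL + 7 * n + 21) + 2 * num s rL + 2 * (n * n) + 20 \<le> T"
  shows "ok high_row s T (\<lambda>s'. num s' rE = num s rL + card (high (arr s aG) n (num s rK) (num s rL)) \<and>
    (\<forall>p<n * n. arr s' aG p = arr s aG p) \<and>
    row (arr s' aG) n n = high (arr s aG) n (num s rK) (num s rL))" (is "ok _ _ _ ?Q")
proof -
  let ?g = "arr s aG" let ?k = "num s rK" let ?l = "num s rL"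
  let ?hi = "\<lambda>i. ?k \<le> card (row ?g n i) + ?l"
  let ?s = "s\<lparr>num := (num s)(rE := ?l, rW := n * n, rQ := 0, rI := 0)\<rparr>"
  have "ok (While (Lt rI rN) high_body) ?s (n * (2 * ?l + 7 * n + 21) + 1) ?Q"
  proof (rule ok_for[where I = "\<lambda>i s'. num s' rI = i \<and> num s' rQ = i * n \<and> num s' rW = n * n + i \<and>
      num s' rE = ?l + card {i'. i' < i \<and> ?hi i'} \<and> (\<forall>p<n * n. arr s' aG p = ?g p) \<and>
      (\<forall>i'<i. arr s' aG (n * n + i') = ?hi i')" and n = n and T = "2 * ?l + 7 * n + 20"], goal_cases)
    case (2 i s')
    have fr: "num s' rN = n" "num s' rL = ?l" "num s' rK = ?k" using 2(3) N by (auto simp: frame_def)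
    have r: "row (arr s' aG) n i = row ?g n i" using 2 by (intro row_cong) auto
    have "ok high_body s' (2 * ?l + 7 * n + 20) (\<lambda>s2. num s2 rI = Suc i \<and> num s2 rQ = Suc i * n \<and> num s2 rW = n * n + Suc i \<and>
      num s2 rE = ?l + card {i'. i' < Suc i \<and> ?hi i'} \<and> (\<forall>p<n * n. arr s2 aG p = ?g p) \<and>
      (\<forall>i'<Suc i. arr s2 aG (n * n + i') = ?hi i'))"
      by (rule ok_mono[OF ok_high_body[OF _ _ order_refl, where i = i]])
        (use 2 fr r in \<open>auto simp: card_less_Suc_Collect All_less_Suc\<close>)
    then show ?case using 2 fr by simp
  next
    case (3 s')
    then show ?case using N by (auto simp: frame_def high_def row_def)
  qed (auto simp: N)
  then have *: "ok (Do (Zero rQ) ;; Do (Zero rI) ;; While (Lt rI rN) high_body)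
     (s\<lparr>num := (num s)(rE := ?l, rW := n * n)\<rparr>) (n * (2 * ?l + 7 * n + 21) + 5) ?Q" by simp
  have "ok (copy rW rP ;; Do (Zero rQ) ;; Do (Zero rI) ;; While (Lt rI rN) high_body)
     (s\<lparr>num := (num s)(rE := ?l)\<rparr>) (n * (2 * ?l + 7 * n + 21) + 2 * (n * n) + 9) ?Q"
    by (rule ok_Seq[OF ok_copy[OF _ order_refl], where U = "n * (2 * ?l + 7 * n + 21) + 5"]) (use * P in auto)
  note ** = this
  show ?thesis unfolding high_row_def
    by (rule ok_Seq[OF ok_copy[OF _ order_refl], where U = "n * (2 * ?l + 7 * n + 21) + 2 * (n * n) + 9"]) (use ** T in auto)
qed

text \<open>The loop ends with \<open>rL\<close> one above the least suitable value; the second increment guarantees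
  \<open>rL \<ge> 1\<close>, without which \<open>search_row\<close> would make no trial at all.\<close>

definition threshold :: com where
  "threshold = While (Lt rE rK) (high_row ;; Do (Inc rL)) ;; Do (Inc rL)"

lemma threshold_frame [simp]: "regs threshold = {rD, rJ, rQ, rE, rW, rI, rL}" "arrs threshold = {aG}" "reads threshold = False"
  by (auto simp: threshold_def)

lemma high_cong: "(\<And>p. p < n * n \<Longrightarrow> g p = h p) \<Longrightarrow> high g n k l = high h n k l"
  using row_cong[of n g h] by (auto simp: high_def)

lemma high_mono: "l \<le> l' \<Longrightarrow> high g n k l \<subseteq> high g n k l'"
  by (auto simp: high_def)

lemma finite_high [simp]: "finite (high g n k l)"
  by (auto simp: high_def)

text \<open>The loop stops one above the least suitable value, which is at most \<open>l0\<close>,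
  and the second increment adds one more: hence \<open>l0 + 2\<close>. Row \<open>n\<close> was
  computed for the smaller value; that is harmless, as both final claims about it survive an
  increase of \<open>l\<close>.\<close>

lemma ok_threshold:
  assumes N: "num s rN = n" and P: "num s rP = n * n" and L: "num s rL = 0" and E: "num s rE = 0"
    and l0: "num s rK \<le> l0 + card (high (arr s aG) n (num s rK) l0)" "l0 \<le> n"
    and empty: "row (arr s aG) n n = {}"
    and T: "(n + 1) * (n * (9 * n + 21) + 2 * n + 2 * (n * n) + 24) + 4 \<le> T"
  shows "ok threshold s T (\<lambda>s'. 1 \<le> num s' rL \<and> num s' rL \<le> l0 + 2 \<and>
    (\<forall>p<n * n. arr s' aG p = arr s aG p) \<and>
    row (arr s' aG) n n \<subseteq> high (arr s aG) n (num s rK) (num s' rL) \<and>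
    num s rK \<le> num s' rL + card (row (arr s' aG) n n))" (is "ok _ _ _ ?Q")
proof -
  let ?k = "num s rK" let ?g = "arr s aG"
  define good where "good l \<longleftrightarrow> ?k \<le> l + card (high ?g n ?k l)" for l
  define l1 where "l1 = (LEAST l. good l)"
  have "good l0" using l0 by (simp add: good_def)
  then have l1: "good l1" "l1 \<le> l0" "\<And>l. l < l1 \<Longrightarrow> \<not> good l"
    unfolding l1_def by (auto intro: LeastI Least_le dest: not_less_Least)
  \<comment> \<open>The number of rounds. For \<open>k = 0\<close> the loop is not entered and row
    \<open>n\<close> keeps its initial value, the empty set.\<close>
  define r where "r = (if ?k = 0 then 0 else Suc l1)"
  let ?t = "n * (9 * n + 21) + 2 * n + 2 * (n * n) + 23"
  have loop: "ok (While (Lt rE rK) (high_row ;; Do (Inc rL))) s (r * (?t + 1) + 1)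
    (\<lambda>s'. num s' rL = r \<and> (\<forall>p<n * n. arr s' aG p = ?g p) \<and>
      row (arr s' aG) n n = (if r = 0 then {} else high ?g n ?k l1))"
  proof (rule ok_for[where I = "\<lambda>i s'. num s' rL = i \<and> (\<forall>p<n * n. arr s' aG p = ?g p) \<and>
      row (arr s' aG) n n = (if i = 0 then {} else high ?g n ?k (i - 1)) \<and>
      num s' rE = (if i = 0 then 0 else i - 1 + card (high ?g n ?k (i - 1)))" and n = r and T = ?t], goal_cases)
    case (2 i s')
    have fr: "num s' rN = n" "num s' rK = ?k" "num s' rP = n * n" using 2(3) N P by (auto simp: frame_def)
    have lt: "num s' rE < ?k"
    proof (cases "i = 0")
      case True
      then show ?thesis using 2 by (auto simp: r_def split: if_splits)
    next
      case False
      then have "i - 1 < l1" using 2(1) by (auto simp: r_def split: if_splits)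
      then show ?thesis using l1(3)[of "i - 1"] 2 False by (simp add: good_def)
    qed
    have i: "i \<le> n" using 2(1) l1 l0 by (auto simp: r_def split: if_splits)
    then have "i * n \<le> n * n" by (rule mult_le_mono1)
    moreover have "n * (2 * i + 7 * n + 21) = 2 * (i * n) + 7 * (n * n) + 21 * n" "n * (9 * n + 21) = 9 * (n * n) + 21 * n"
      by (simp_all add: algebra_simps)
    ultimately have "n * (2 * i + 7 * n + 21) + 2 * i + 2 * (n * n) + 20 \<le> ?t - 3"
      using i by linarith
    moreover have "high (arr s' aG) n ?k i = high ?g n ?k i" using 2 by (intro high_cong) auto
    ultimately have "ok high_row s' (?t - 3) (\<lambda>s2. num s2 rE = i + card (high ?g n ?k i) \<and>
       (\<forall>p<n * n. arr s2 aG p = ?g p) \<and> row (arr s2 aG) n n = high ?g n ?k i)"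
      by (intro ok_mono[OF ok_high_row[OF fr(1,3) order_refl]]) (use 2 fr in auto)
    then have "ok (high_row ;; Do (Inc rL)) s' ?t (\<lambda>s2. num s2 rL = Suc i \<and> (\<forall>p<n * n. arr s2 aG p = ?g p) \<and>
      row (arr s2 aG) n n = high ?g n ?k i \<and> num s2 rE = i + card (high ?g n ?k i))"
      by (rule ok_Seq[where U = 1]) (use 2 in \<open>auto simp: frame_def\<close>)
    then show ?case using lt fr by simp
  next
    case (3 s')
    have fr: "num s' rK = ?k" using 3(2) by (auto simp: frame_def)
    show ?case using 3(1) fr l1(1) by (auto simp: r_def good_def split: if_splits)
  qed (use L E empty in auto)
  have "r * (?t + 1) \<le> (n + 1) * (?t + 1)"
    using l1 l0 by (intro mult_le_mono1) (auto simp: r_def)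
  then have le: "r * (?t + 1) + 1 + 1 + 1 \<le> T" using T by (simp add: ac_simps)
  show ?thesis unfolding threshold_def
  proof (rule ok_Seq[OF loop, where U = 1], goal_cases)
    case (1 s')
    \<comment> \<open>\<open>Suc r\<close> is the final value of \<open>rL\<close>, two above
      \<open>l1\<close>.\<close>
    have "card (high ?g n ?k l1) \<le> card (high ?g n ?k (Suc r))" if "r = Suc l1"
      using that by (intro card_mono high_mono) auto
    then show ?case using 1 l1(1,2) high_mono[of l1 "Suc r" ?g n ?k]
      by (auto simp: r_def good_def frame_def split: if_splits)
  qed (use le in auto)
qed

section \<open>The bounded search\<close>

text \<open>The pair \<open>(i, j)\<close> has index \<open>p = i * n + j\<close>, and bit \<open>t\<close> of \<open>b\<close> selects the endpoint that covers the
  \<open>t\<close>-th uncovered edge met by the scan.\<close>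

fun cover_run :: "(nat \<Rightarrow> bool) \<Rightarrow> nat \<Rightarrow> (nat \<Rightarrow> bool) \<Rightarrow> nat set \<Rightarrow> nat \<Rightarrow> nat set \<times> nat" where
  "cover_run g n b X 0 = (X, 0)"
| "cover_run g n b X (Suc p) = (case cover_run g n b X p of (Y, t) \<Rightarrow>
     if g p \<and> p div n \<notin> Y \<and> p mod n \<notin> Y then (insert (if b t then p div n else p mod n) Y, Suc t)
     else (Y, t))"

definition init_X :: com where
  "init_X = copy rQ rO ;; Do (Zero rJ) ;; While (Lt rJ rN)
     (Ite (Bit aG rQ) (Do (Set aX rJ True)) (Do (Set aX rJ False)) ;; Do (Inc rQ) ;; Do (Inc rJ))"

lemma init_X_frame [simp]: "regs init_X = {rQ, rJ}" "arrs init_X = {aX}" "reads init_X = False"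
  by (auto simp: init_X_def)

lemma ok_init_X:
  assumes "7 * num s rN + 2 * num s rO + 8 \<le> T"
  shows "ok init_X s T (\<lambda>s'. \<forall>x<num s rN. arr s' aX x = arr s aG (num s rO + x))"
proof -
  let ?s = "s\<lparr>num := (num s)(rQ := num s rO, rJ := 0)\<rparr>"
  have "ok (While (Lt rJ rN) (Ite (Bit aG rQ) (Do (Set aX rJ True)) (Do (Set aX rJ False)) ;; Do (Inc rQ) ;; Do (Inc rJ)))
    ?s (num s rN * 7 + 1) (\<lambda>s'. \<forall>x<num s rN. arr s' aX x = arr s aG (num s rO + x))"
    by (rule ok_for[where I = "\<lambda>j s'. num s' rJ = j \<and> num s' rQ = num s rO + j \<and>
       (\<forall>x<j. arr s' aX x = arr s aG (num s rO + x))" and n = "num s rN" and T = 6])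
      (auto simp: frame_def less_Suc_eq)
  note * = this
  show ?thesis unfolding init_X_def
    by (rule ok_Seq[OF ok_copy[OF _ order_refl], where U = "num s rN * 7 + 3"]) (use * assms in auto)
qed

definition cover_body :: com where
  "cover_body = Ite (Bit aG rQ) (Ite (Bit aX rI) skip (Ite (Bit aX rJ) skip
     (Ite (Bit aB rT) (Do (Set aX rI True)) (Do (Set aX rJ True)) ;; Do (Inc rT)))) skip ;;
     Do (Inc rQ) ;; Do (Inc rJ)"

definition cover :: com where
  "cover = Do (Zero rT) ;; Do (Zero rQ) ;; Do (Zero rI) ;;
     While (Lt rI rN) (Do (Zero rJ) ;; While (Lt rJ rN) cover_body ;; Do (Inc rI))"

lemma cover_body_frame [simp]: "regs cover_body = {rT, rQ, rJ}" "arrs cover_body = {aX}" "reads cover_body = False"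
  by (auto simp: cover_body_def)

lemma cover_frame [simp]: "regs cover = {rT, rQ, rI, rJ}" "arrs cover = {aX}" "reads cover = False"
  by (auto simp: cover_def)

definition cover_inv :: "store \<Rightarrow> nat \<Rightarrow> nat \<Rightarrow> nat \<Rightarrow> store \<Rightarrow> bool" where
  "cover_inv s n i j s' \<longleftrightarrow> num s' rI = i \<and> num s' rJ = j \<and> num s' rQ = i * n + j \<and> num s' rN = n \<and>
     arr s' aG = arr s aG \<and> arr s' aB = arr s aB \<and>
     (case cover_run (arr s aG) n (arr s aB) {x. x < n \<and> arr s aX x} (i * n + j) of (Y, t) \<Rightarrow>
       num s' rT = t \<and> (\<forall>x<n. arr s' aX x = (x \<in> Y)))"

lemma ok_cover_body:
  assumes "cover_inv s n i j s'" "i < n" "j < n"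
  shows "ok cover_body s' 12 (cover_inv s n i (Suc j))"
proof -
  have "(i * n + j) div n = i" "(i * n + j) mod n = j" using assms by auto
  then show ?thesis using assms
    by (auto simp: cover_inv_def cover_body_def split: prod.splits)
qed

lemma ok_cover:
  assumes N: "num s rN = n" and T: "n * (13 * n + 7) + 8 \<le> T"
  shows "ok cover s T (\<lambda>s'. \<forall>x<n. arr s' aX x =
    (x \<in> fst (cover_run (arr s aG) n (arr s aB) {x. x < n \<and> arr s aX x} (n * n))))"
proof -
  let ?s = "s\<lparr>num := (num s)(rT := 0, rQ := 0, rI := 0)\<rparr>"
  have "ok (While (Lt rI rN) (Do (Zero rJ) ;; While (Lt rJ rN) cover_body ;; Do (Inc rI))) ?s (n * (13 * n + 7) + 1)
    (\<lambda>s'. \<forall>x<n. arr s' aX x = (x \<in> fst (cover_run (arr s aG) n (arr s aB) {x. x < n \<and> arr s aX x} (n * n))))"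
  \<comment> \<open>The outer invariant is stated as if \<open>rJ\<close> were already reset: a
    round ends with \<open>j = n\<close>, and \<open>i * n + n\<close> is the position where row
    \<open>Suc i\<close> begins.\<close>
  proof (rule ok_for[where I = "\<lambda>i s'. cover_inv s n i 0 (peff (Zero rJ) s')" and n = n and T = "13 * n + 6"], goal_cases)
    case 1
    then show ?case using N by (auto simp: cover_inv_def)
  next
    case (2 i s')
    have "ok (While (Lt rJ rN) cover_body) (peff (Zero rJ) s') (n * (12 + 1) + 1) (cover_inv s n i n)"
      by (rule ok_for[where I = "cover_inv s n i" and n = n and T = 12])
        (use 2 ok_cover_body[of s n i] in \<open>auto simp: cover_inv_def\<close>)
    then have "ok (While (Lt rJ rN) cover_body ;; Do (Inc rI)) (peff (Zero rJ) s') (13 * n + 4)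
       (\<lambda>s'. cover_inv s n (Suc i) 0 (peff (Zero rJ) s'))"
      by (rule ok_Seq[where U = 1]) (auto simp: cover_inv_def add.commute)
    moreover have "num s' rI = i" "num s' rN = n" using 2(2) by (auto simp: cover_inv_def)
    ultimately show ?case using 2(1) by (simp add: add.commute)
  next
    case (3 s')
    then show ?case by (auto simp: cover_inv_def split: prod.splits)
  qed auto
  then have "ok cover s (n * (13 * n + 7) + 7) (\<lambda>s'. \<forall>x<n. arr s' aX x =
    (x \<in> fst (cover_run (arr s aG) n (arr s aB) {x. x < n \<and> arr s aX x} (n * n))))"
    by (simp add: cover_def)
  then show ?thesis by (rule ok_mono) (use T in auto)
qed

text \<open>\<open>rR\<close> is never reset; it is positive at the end iff some trial succeeded, as
  the final test against \<open>rZ\<close> requires.\<close>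

definition check_size :: com where
  "check_size = Do (Zero rD) ;; Do (Zero rI) ;;
     While (Lt rI rN) (Ite (Bit aX rI) (Do (Inc rD)) skip ;; Do (Inc rI)) ;;
     Ite (Lt rK rD) skip (Do (Inc rR))"

lemma check_size_frame [simp]: "regs check_size = {rD, rI, rR}" "arrs check_size = {}" "reads check_size = False"
  by (auto simp: check_size_def)

lemma ok_check_size:
  assumes "5 * num s rN + 8 \<le> T"
  shows "ok check_size s T (\<lambda>s'. num s' rR = num s rR +
    of_bool (card {x. x < num s rN \<and> arr s aX x} \<le> num s rK))"
proof -
  let ?s = "s\<lparr>num := (num s)(rD := 0, rI := 0)\<rparr>"
  have "ok (While (Lt rI rN) (Ite (Bit aX rI) (Do (Inc rD)) skip ;; Do (Inc rI))) ?s (num s rN * 5 + 1)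
    (\<lambda>s'. num s' rD = card {x. x < num s rN \<and> arr s aX x})"
    by (rule ok_for[where I = "\<lambda>i s'. num s' rI = i \<and> num s' rD = card {x. x < i \<and> arr s aX x}" and n = "num s rN" and T = 4])
      (auto simp: frame_def card_less_Suc_Collect)
  then have "ok (While (Lt rI rN) (Ite (Bit aX rI) (Do (Inc rD)) skip ;; Do (Inc rI)) ;; Ite (Lt rK rD) skip (Do (Inc rR)))
    ?s (num s rN * 5 + 4) (\<lambda>s'. num s' rR = num s rR + of_bool (card {x. x < num s rN \<and> arr s aX x} \<le> num s rK))"
    by (rule ok_Seq[where U = 2]) (auto simp: frame_def)
  then show ?thesis using assms by (simp add: check_size_def split del: split_of_bool) (intro conjI, simp, erule ok_time, simp)
qed

definition trial :: com where "trial = init_X ;; cover ;; check_size"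

lemma trial_frame [simp]: "regs trial = {rQ, rJ, rT, rI, rD, rR}" "arrs trial = {aX}" "reads trial = False"
  by (auto simp: trial_def)

text \<open>The binary digits of \<open>m\<close> are the branching choices. Choices beyond the
  digits of \<open>m\<close> default to 0; the run still yields a vertex cover, and only its size
  decides.\<close>

definition success :: "(nat \<Rightarrow> bool) \<Rightarrow> nat \<Rightarrow> nat \<Rightarrow> nat \<Rightarrow> nat \<Rightarrow> bool" where
  "success g n k c m \<longleftrightarrow> card {x. x < n \<and> x \<in> fst (cover_run g n (bit m) (row g n c) (n * n))} \<le> k"

lemma ok_trial:
  assumes N: "num s rN = n" and O: "num s rO = c * n" "c \<le> n" and B: "arr s aB = bit (m::nat)"
    and T: "15 * (n * n) + 19 * n + 26 \<le> T"
  shows "ok trial s T (\<lambda>s'. num s' rR = num s rR + of_bool (success (arr s aG) n (num s rK) c m))"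
  unfolding trial_def
proof (rule ok_Seq[OF ok_init_X[OF order_refl], where U = "13 * (n * n) + 12 * n + 17"], goal_cases)
  case (1 s1)
  have row: "{x. x < n \<and> arr s1 aX x} = row (arr s aG) n c"
    using 1 N O by (auto simp: row_def)
  have fr: "num s1 rN = n" "arr s1 aG = arr s aG" "arr s1 aB = bit m" "num s1 rR = num s rR" "num s1 rK = num s rK"
    using 1 N B by (auto simp: frame_def)
  show ?case
  proof (rule ok_Seq[OF ok_cover[OF fr(1) order_refl], where U = "5 * n + 8"], goal_cases)
    case (1 s2)
    have "{x. x < n \<and> arr s2 aX x} = {x. x < n \<and> x \<in> fst (cover_run (arr s aG) n (bit m) (row (arr s aG) n c) (n * n))}"
      using 1(1) row fr by auto
    then show ?case
      by (intro ok_mono[OF ok_check_size[OF order_refl]])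
        (use 1(2) fr in \<open>auto simp: frame_def success_def\<close>)
  qed (auto simp: algebra_simps)
next
  case 2
  have "c * n \<le> n * n" using O by simp
  then show ?case unfolding N O(1) using T by linarith
qed

definition increment :: com where
  "increment = Do (Zero rM) ;; While (Bit aB rM) (Do (Set aB rM False) ;; Do (Inc rM)) ;; Do (Set aB rM True)"

lemma increment_frame [simp]: "regs increment = {rM}" "arrs increment = {aB}" "reads increment = False"
  by (auto simp: increment_def)

lemma bit_Suc_carry:
  fixes m :: nat
  assumes "\<And>i. i < q \<Longrightarrow> bit m i" "\<not> bit m q"
  shows "bit (Suc m) i = (if i < q then False else if i = q then True else bit m i)"
  using assms
proof (induction q arbitrary: m i)
  case 0
  then have "even m" by (simp add: bit_0)
  then show ?case by (cases i) (auto simp: bit_0 bit_Suc)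
next
  case (Suc q)
  have "odd m" using Suc.prems(1)[of 0] by (simp add: bit_0)
  then have d: "Suc m div 2 = Suc (m div 2)" "even (Suc m)" by auto
  have IH: "bit (Suc (m div 2)) i = (if i < q then False else if i = q then True else bit (m div 2) i)" for i
    using Suc.IH[of "m div 2" i] Suc.prems(1)[of "Suc _"] Suc.prems(2) by (auto simp: bit_Suc)
  show ?case using d IH by (cases i) (auto simp: bit_0 bit_Suc)
qed

text \<open>The carry stops at the least unset bit. For \<open>m < 2 ^ l\<close> this position is at
  most \<open>l\<close>, and it equals \<open>l\<close> exactly if all lower bits are set; comparing
  \<open>rM\<close> with \<open>rL\<close> thus tells whether choices are left.\<close>

lemma ok_increment:
  fixes m :: nat
  assumes B: "arr s aB = bit m" and m: "m < 2 ^ l" and T: "4 * l + 8 \<le> T"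
  shows "ok increment s T (\<lambda>s'. arr s' aB = bit (Suc m) \<and> bit (Suc m) (num s' rM) \<and>
    (num s' rM < l \<longleftrightarrow> Suc m < 2 ^ l))"
proof -
  have "\<not> bit m l" using m by (simp add: bit_iff_odd)
  define q where "q = (LEAST i. \<not> bit m i)"
  have q: "\<not> bit m q" "q \<le> l" "\<And>i. i < q \<Longrightarrow> bit m i"
    unfolding q_def using \<open>\<not> bit m l\<close> LeastI[of "\<lambda>i. \<not> bit m i" l]
    by (auto intro: Least_le dest: not_less_Least)
  have "q < l \<longleftrightarrow> Suc m < 2 ^ l"
  proof
    assume "q < l"
    \<comment> \<open>An unset bit below \<open>l\<close> separates \<open>m\<close> from the
      largest number with \<open>l\<close> bits.\<close>
    have "m \<noteq> mask l" using q(1) \<open>q < l\<close> by (auto simp: bit_mask_iff)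
    then show "Suc m < 2 ^ l" using m by (simp add: mask_eq_exp_minus_1)
  next
    assume *: "Suc m < 2 ^ l"
    show "q < l"
    proof (rule ccontr)
      assume "\<not> q < l"
      then have ql: "q = l" using q(2) by simp
      have "\<not> bit (Suc m) l" using * by (simp add: bit_iff_odd)
      then show False using bit_Suc_carry[of q m l] q ql by simp
    qed
  qed
  note ql = this
  have "ok (While (Bit aB rM) (Do (Set aB rM False) ;; Do (Inc rM))) (peff (Zero rM) s) (q * 4 + 1)
    (\<lambda>s'. num s' rM = q \<and> (\<forall>i. arr s' aB i = (q \<le> i \<and> bit m i)))"
    by (rule ok_for[where I = "\<lambda>j s'. num s' rM = j \<and> (\<forall>i. arr s' aB i = (j \<le> i \<and> bit m i))" and n = q and T = 3])
      (use B q in auto)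
  then have "ok (While (Bit aB rM) (Do (Set aB rM False) ;; Do (Inc rM)) ;; Do (Set aB rM True)) (peff (Zero rM) s) (q * 4 + 3)
    (\<lambda>s'. arr s' aB = bit (Suc m) \<and> bit (Suc m) (num s' rM) \<and> (num s' rM < l \<longleftrightarrow> Suc m < 2 ^ l))"
  proof (rule ok_Seq[where U = 1], goal_cases)
    case (1 s')
    have "(arr s' aB)(q := True) = bit (Suc m)"
    proof
      fix i
      show "((arr s' aB)(q := True)) i = bit (Suc m) i"
        using 1(1) bit_Suc_carry[OF q(3,1), of i] by auto
    qed
    then show ?case using 1(1) ql bit_Suc_carry[OF q(3,1), of q] by simp
  qed auto
  then show ?thesis using T q(2) by (simp add: increment_def) (erule ok_time, simp)
qed

text \<open>\<open>rM\<close> serves as loop test between increments. When the counter reaches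
  \<open>2 ^ l\<close>, its single one is at position \<open>rM = l\<close>, and clearing it resets
  the counter for the next row.\<close>

definition search_row :: com where
  "search_row = Do (Zero rM) ;; While (Lt rM rL) (trial ;; increment) ;; Do (Set aB rM False)"

lemma search_row_frame [simp]: "regs search_row = {rM, rQ, rJ, rT, rI, rD, rR}" "arrs search_row = {aX, aB}"
  "reads search_row = False"
  by (auto simp: search_row_def)

text \<open>The constant 36 consists of 26 for a trial, 8 for an increment and 2 for their sequence
  and the loop test; the 6 covers the code around the loop.\<close>

definition row_time :: "nat \<Rightarrow> nat \<Rightarrow> nat" where
  "row_time n l = 2 ^ l * (15 * (n * n) + 19 * n + 4 * l + 36) + 6"

lemma ok_search_row:
  assumes N: "num s rN = n" and O: "num s rO = c * n" "c \<le> n" and B: "arr s aB = (\<lambda>_. False)"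
    and L: "num s rL = l" "1 \<le> l"
  shows "ok search_row s (row_time n l) (\<lambda>s'. arr s' aB = (\<lambda>_. False) \<and>
    (0 < num s' rR \<longleftrightarrow> 0 < num s rR \<or> (\<exists>m<2 ^ l. success (arr s aG) n (num s rK) c m)))"
proof -
  have bit0: "bit (0::nat) = (\<lambda>_. False)" by auto
  \<comment> \<open>The clause on \<open>bit i\<close> identifies \<open>rM\<close> at the exit:
    \<open>l\<close> is the only position set in \<open>2 ^ l\<close>.\<close>
  let ?I = "\<lambda>i s'. arr s' aB = bit i \<and> (num s' rM < l \<longleftrightarrow> i < 2 ^ l) \<and> (0 < i \<longrightarrow> bit i (num s' rM)) \<and>
      (0 < num s' rR \<longleftrightarrow> 0 < num s rR \<or> (\<exists>m<i. success (arr s aG) n (num s rK) c m))"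
  let ?t = "15 * (n * n) + 19 * n + 4 * l + 35"
  have "ok (While (Lt rM rL) (trial ;; increment)) (peff (Zero rM) s) (2 ^ l * (?t + 1) + 1) (?I (2 ^ l))"
  proof (rule ok_for[where I = ?I and n = "2 ^ l" and T = ?t], goal_cases)
    case (2 i s')
    have fr: "num s' rN = n" "num s' rO = c * n" "num s' rL = l" "num s' rK = num s rK" "arr s' aG = arr s aG"
      using 2(3) N O L by (auto simp: frame_def)
    have "ok (trial ;; increment) s' ?t (?I (Suc i))"
    proof (rule ok_Seq[OF ok_trial[OF fr(1,2) O(2) _ order_refl, where m = i], where U = "4 * l + 8"])
      fix s2
      assume R: "num s2 rR = num s' rR + of_bool (success (arr s' aG) n (num s' rK) c i)"
        and s2: "frame trial s' s2"
      have B2: "arr s2 aB = bit i" using 2(2) s2 by (auto simp: frame_def)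
      have R2: "0 < num s2 rR \<longleftrightarrow> 0 < num s rR \<or> (\<exists>m<Suc i. success (arr s aG) n (num s rK) c m)"
        using R 2(2) unfolding fr less_Suc_eq by auto
      show "ok increment s2 (4 * l + 8) (?I (Suc i))"
        by (rule ok_mono[OF ok_frame[OF ok_increment[OF B2 2(1) order_refl]]])
          (use R2 in \<open>simp_all add: frame_def\<close>)
    qed (use 2 in auto)
    then show ?case using 2 fr by simp
  next
    case (3 s')
    have "num s' rL = l" using 3(2) L by (simp add: frame_def)
    then show ?case using 3(1) by simp
  qed (use B L bit0 in auto)
  then have "ok (While (Lt rM rL) (trial ;; increment) ;; Do (Set aB rM False)) (peff (Zero rM) s) (2 ^ l * (?t + 1) + 3)
    (\<lambda>s'. arr s' aB = (\<lambda>_. False) \<and>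
    (0 < num s' rR \<longleftrightarrow> 0 < num s rR \<or> (\<exists>m<2 ^ l. success (arr s aG) n (num s rK) c m)))"
  proof (rule ok_Seq[where U = 1], goal_cases)
    case (1 s')
    have "bit ((2::nat) ^ l) (num s' rM)" using 1(1) by simp
    then have "num s' rM = l" by (simp add: bit_exp_iff)
    then have "(arr s' aB)(num s' rM := False) = (\<lambda>_. False)"
      using 1(1) by (intro ext) (auto simp: bit_exp_iff)
    then show ?case using 1(1) by simp
  qed auto
  then show ?thesis by (simp add: search_row_def row_time_def) (erule ok_time, simp add: ac_simps)
qed


text \<open>The rows are 0 to \<open>n\<close>, including the extra one, hence the bound
  \<open>n + 1\<close> in \<open>rV\<close>. The offset \<open>rO\<close> is advanced by additions,
  as the language cannot multiply.\<close>

definition search :: com where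
  "search = copy rV rN ;; Do (Inc rV) ;; While (Lt rC rV) (search_row ;; Do (Zero rJ) ;;
     While (Lt rJ rN) (Do (Inc rJ) ;; Do (Inc rO)) ;; Do (Inc rC))"

lemma ok_search:
  assumes N: "num s rN = n" and L: "num s rL = l" "1 \<le> l"
    and zero: "num s rO = 0" "num s rC = 0" "num s rR = 0" and B: "arr s aB = (\<lambda>_. False)"
    and T: "(n + 1) * (row_time n l + 4 * n + 9) + 2 * n + 10 \<le> T"
  shows "ok search s T (\<lambda>s'. 0 < num s' rR \<longleftrightarrow> (\<exists>c\<le>n. \<exists>m<2 ^ l. success (arr s aG) n (num s rK) c m))"
proof -
  let ?s = "s\<lparr>num := (num s)(rV := Suc n)\<rparr>"
  let ?t = "row_time n l + 4 * n + 8"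
  let ?S = "\<lambda>c. \<exists>m<2 ^ l. success (arr s aG) n (num s rK) c m"
  let ?add = "While (Lt rJ rN) (Do (Inc rJ) ;; Do (Inc rO))"
  let ?I = "\<lambda>i s'. num s' rC = i \<and> num s' rO = i * n \<and> arr s' aB = (\<lambda>_. False) \<and>
    (0 < num s' rR \<longleftrightarrow> (\<exists>c<i. ?S c))"
  have "ok (While (Lt rC rV) (search_row ;; Do (Zero rJ) ;; ?add ;; Do (Inc rC))) ?s (Suc n * (?t + 1) + 1) (?I (Suc n))"
  proof (rule ok_for[where I = ?I and n = "Suc n" and T = ?t], goal_cases)
    case (2 i s')
    have fr: "num s' rN = n" "num s' rL = l" "num s' rK = num s rK" "num s' rV = Suc n" "arr s' aG = arr s aG"
      using 2(3) N L by (auto simp: frame_def search_row_def)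
    have "ok (search_row ;; Do (Zero rJ) ;; ?add ;; Do (Inc rC)) s' ?t (?I (Suc i))"
    proof (rule ok_Seq[OF ok_search_row[OF fr(1) _ _ _ fr(2) L(2), where c = i], where U = "4 * n + 7"])
      fix s1
      assume s1: "arr s1 aB = (\<lambda>_. False) \<and> (0 < num s1 rR \<longleftrightarrow> 0 < num s' rR \<or>
          (\<exists>m<2 ^ l. success (arr s' aG) n (num s' rK) i m))"
        and f1: "frame search_row s' s1"
      have n1: "num s1 rN = n" "num s1 rO = i * n" "num s1 rC = i" using f1 fr 2(2) by (auto simp: frame_def)
      have R1: "0 < num s1 rR \<longleftrightarrow> (\<exists>c<Suc i. ?S c)"
        using s1 2(2) unfolding fr less_Suc_eq by auto
      have "ok ?add (peff (Zero rJ) s1) (n * 4 + 1) (\<lambda>s2. num s2 rO = Suc i * n)"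
        by (rule ok_for[where I = "\<lambda>j s2. num s2 rJ = j \<and> num s2 rO = i * n + j" and n = n and T = 3])
          (use n1 in \<open>auto simp: frame_def\<close>)
      then have "ok (?add ;; Do (Inc rC)) (peff (Zero rJ) s1) (n * 4 + 3) (?I (Suc i))"
        by (rule ok_Seq[where U = 1]) (use n1 s1 R1 in \<open>auto simp: frame_def\<close>)
      then show "ok (Do (Zero rJ) ;; ?add ;; Do (Inc rC)) s1 (4 * n + 7) (?I (Suc i))"
        by simp (erule ok_time, simp)
    qed (use 2 in auto)
    then show ?case using 2 fr by simp
  next
    case (3 s')
    have "num s' rV = Suc n" using 3(2) by (auto simp: frame_def search_row_def)
    then show ?case using 3(1) by simp
  qed (use zero B in auto)
  then have loop: "ok (While (Lt rC rV) (search_row ;; Do (Zero rJ) ;; ?add ;; Do (Inc rC))) ?s (Suc n * (?t + 1) + 1)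
    (\<lambda>s'. 0 < num s' rR \<longleftrightarrow> (\<exists>c\<le>n. ?S c))"
    by (rule ok_mono) (auto simp: less_Suc_eq_le)
  have "Suc n * (?t + 1) + 2 * n + 10 \<le> T" using T by (simp add: ac_simps)
  then show ?thesis unfolding search_def
    by (intro ok_Seq[OF ok_copy[OF _ order_refl], where U = "Suc n * (?t + 1) + 3"]) (use N loop in auto)
qed

text \<open>Holds for every choice \<open>b\<close>: an edge is covered when the scan meets it, and
  the set only grows afterwards.\<close>

lemma cover_run_sound:
  assumes "X \<subseteq> {..<n}" "p \<le> n * n"
  shows "fst (cover_run g n b X p) \<subseteq> {..<n} \<and>
    (\<forall>q<p. g q \<longrightarrow> q div n \<in> fst (cover_run g n b X p) \<or> q mod n \<in> fst (cover_run g n b X p))"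
  using assms(2)
proof (induction p)
  case (Suc p)
  have "0 < n" using Suc.prems by (cases n) auto
  moreover have "p div n < n" using Suc.prems by (simp add: less_mult_imp_div_less)
  ultimately show ?case using Suc by (auto split: prod.splits simp: less_Suc_eq)
qed (use assms in auto)

text \<open>\<open>A\<close> collects the branchings whose first endpoint lies in \<open>Y\<close>;
  otherwise the second one does. Guided by \<open>A\<close> the run stays inside \<open>Y\<close>,
  and each branching adds a new vertex. Only the first \<open>t\<close> choices matter, so
  \<open>b\<close> is left free beyond them.\<close>

lemma cover_run_complete:
  assumes Y: "\<And>q. q < p \<Longrightarrow> g q \<Longrightarrow> q div n \<in> Y \<or> q mod n \<in> Y" and X: "X \<subseteq> Y" "finite Y"
  shows "\<exists>A Z t. A \<subseteq> {..<t} \<and> (\<forall>b. (\<forall>i<t. b i = (i \<in> A)) \<longrightarrow> cover_run g n b X p = (Z, t)) \<and>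
    Z \<subseteq> Y \<and> card Z = card X + t"
  using Y
proof (induction p)
  case 0
  then show ?case using X by (intro exI[of _ "{}"] exI[of _ X] exI[of _ 0]) auto
next
  case (Suc p)
  then obtain A Z t where IH: "A \<subseteq> {..<t}" "\<And>b. (\<forall>i<t. b i = (i \<in> A)) \<Longrightarrow> cover_run g n b X p = (Z, t)"
    "Z \<subseteq> Y" "card Z = card X + t" by auto
  show ?case
  proof (cases "g p \<and> p div n \<notin> Z \<and> p mod n \<notin> Z")
    case False
    then show ?thesis using IH by (intro exI[of _ A] exI[of _ Z] exI[of _ t]) auto
  next
    case True
    let ?v = "if p div n \<in> Y then p div n else p mod n"
    let ?A = "if p div n \<in> Y then insert t A else A"
    have "?v \<in> Y" "?v \<notin> Z" using Suc.prems[of p] True by auto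
    moreover have "finite Z" using IH(3) X(2) finite_subset by blast
    moreover have "cover_run g n b X (Suc p) = (insert ?v Z, Suc t)" if b: "\<forall>i<Suc t. b i = (i \<in> ?A)" for b
    proof -
      have "t \<notin> A" using IH(1) by auto
      then have "\<forall>i<t. b i = (i \<in> A)" "b t \<longleftrightarrow> p div n \<in> Y" using b by auto
      then show ?thesis using IH(2)[of b] True by simp
    qed
    moreover have "?A \<subseteq> {..<Suc t}" using IH(1) by auto
    ultimately show ?thesis using IH(3,4)
      by (intro exI[of _ ?A] exI[of _ "insert ?v Z"] exI[of _ "Suc t"]) auto
  qed
qed

lemma ex_bits: "A \<subseteq> {..<l} \<Longrightarrow> \<exists>m<2 ^ l. \<forall>i. bit (m::nat) i = (i \<in> A)"
proof -
  assume A: "A \<subseteq> {..<l}"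
  let ?m = "horner_sum of_bool 2 (map (\<lambda>i. i \<in> A) [0..<l]) :: nat"
  have "?m < 2 ^ l" using horner_sum_bound[of "map (\<lambda>i. i \<in> A) [0..<l]", where 'a = nat] by simp
  moreover have "bit ?m i = (i \<in> A)" for i using A by (auto simp: bit_horner_sum_bit_iff)
  ultimately show ?thesis by blast
qed

declare bin.simps [simp del]

section \<open>Correctness of the search\<close>

text \<open>The guard makes row \<open>n\<close> empty before the threshold computation fills
  it.\<close>

definition matrix_bits :: "nat \<Rightarrow> (nat \<Rightarrow> nat \<Rightarrow> bool) \<Rightarrow> nat \<Rightarrow> bool" where
  "matrix_bits n E p \<longleftrightarrow> p < n * n \<and> E (p div n) (p mod n)"

lemma index_less: "i < n \<Longrightarrow> j < n \<Longrightarrow> i * n + j < n * (n::nat)"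
  by (metis add.commute add_less_cancel_left less_le_trans mult.commute mult_Suc_right mult_le_mono2 Suc_leI)

lemma matrix_bits_index: "i < n \<Longrightarrow> j < n \<Longrightarrow> matrix_bits n E (i * n + j) = E i j"
  using index_less[of i n j] by (simp add: matrix_bits_def)

lemma row_matrix_bits: "i < n \<Longrightarrow> row (matrix_bits n E) n i = {j. j < n \<and> E i j}"
  by (auto simp: row_def matrix_bits_index)

lemma row_matrix_bits_last: "row (matrix_bits n E) n n = {}"
  by (auto simp: row_def matrix_bits_def)

lemma card_row_matrix_bits: "i < n \<Longrightarrow> card (row (matrix_bits n E) n i) = degree n E i"
  by (simp add: row_matrix_bits degree_def)

text \<open>The greatest value is attained because the candidates are bounded by
  \<open>n\<close>.\<close>

lemma h_index_card: "h_index n E \<le> card {v. v < n \<and> h_index n E \<le> degree n E v}"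
proof -
  let ?P = "\<lambda>k. k \<le> card {v. v < n \<and> k \<le> degree n E v}"
  have "k \<le> n" if "?P k" for k
  proof -
    have "card {v. v < n \<and> k \<le> degree n E v} \<le> card {..<n}" by (intro card_mono) auto
    then show ?thesis using that by simp
  qed
  then show ?thesis unfolding h_index_def using GreatestI_nat[of ?P 0 n] by simp
qed

text \<open>For \<open>k\<close> at least the h-index, \<open>k - l\<close> is the h-index itself.
  Otherwise \<open>l = 0\<close>, and the vertices witnessing the h-index have degree above
  \<open>k\<close> and are more than enough.\<close>

lemma high_h_index:
  "k \<le> (k - h_index n E) + card (high (matrix_bits n E) n k (k - h_index n E))"
proof -
  have "card {v. v < n \<and> h_index n E \<le> degree n E v} \<le> card (high (matrix_bits n E) n k (k - h_index n E))"
    by (intro card_mono) (auto simp: high_def card_row_matrix_bits)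
  then show ?thesis using h_index_card[of n E] by linarith
qed

text \<open>The inclusion for row \<open>n\<close> serves a cover that misses one of its vertices,
  whose degree must then be large; the bound on its size serves a cover that contains it.\<close>

theorem search_correct:
  assumes g: "\<And>p. p < n * n \<Longrightarrow> g p = matrix_bits n E p" and k': "k' = min n k"
    and H: "row g n n \<subseteq> high (matrix_bits n E) n k' l" "k' \<le> l + card (row g n n)"
  shows "(\<exists>X. vertex_cover n E X \<and> card X \<le> k) \<longleftrightarrow> (\<exists>c\<le>n. \<exists>m<2 ^ l. success g n k' c m)"
proof
  assume "\<exists>c\<le>n. \<exists>m<2 ^ l. success g n k' c m"
  then obtain c m where c: "c \<le> n" "success g n k' c m" by blast
  let ?Z = "fst (cover_run g n (bit m) (row g n c) (n * n))"
  have "row g n c \<subseteq> {..<n}" by (auto simp: row_def)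
  from cover_run_sound[OF this order_refl, of g "bit m"]
  have Z: "?Z \<subseteq> {..<n}" "\<And>q. q < n * n \<Longrightarrow> g q \<Longrightarrow> q div n \<in> ?Z \<or> q mod n \<in> ?Z" by auto
  have "u \<in> ?Z \<or> v \<in> ?Z" if "u < n" "v < n" "E u v" for u v
    using Z(2)[of "u * n + v"] g[of "u * n + v"] index_less[of u n v] matrix_bits_index[of u n v E] that
    by auto
  then have "vertex_cover n E ?Z" using Z(1) by (auto simp: vertex_cover_def)
  moreover have "{x. x < n \<and> x \<in> ?Z} = ?Z" using Z(1) by auto
  ultimately show "\<exists>X. vertex_cover n E X \<and> card X \<le> k" using c(2) k' by (auto simp: success_def)
next
  assume "\<exists>X. vertex_cover n E X \<and> card X \<le> k"
  then obtain Y where Y: "vertex_cover n E Y" "card Y \<le> k" by blast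
  have Yn: "Y \<subseteq> {0..<n}" using Y(1) by (simp add: vertex_cover_def)
  then have fin: "finite Y" using finite_subset by blast
  have "card Y \<le> n" using card_mono[OF _ Yn] by simp
  then have Yk: "card Y \<le> k'" using Y(2) k' by simp
  have row: "row g n i = row (matrix_bits n E) n i" if "i < n" for i
    using that g by (intro row_cong) auto
  obtain c where c: "c \<le> n" "row g n c \<subseteq> Y" "k' \<le> card (row g n c) + l"
  proof (cases "row g n n \<subseteq> Y")
    case True
    then show ?thesis using that[of n] H(2) by simp
  next
    case False
    then obtain v where v: "v \<in> row g n n" "v \<notin> Y" by blast
    then have "v < n" by (auto simp: row_def)
    moreover have "row g n v \<subseteq> Y"
      using Y(1) v(2) \<open>v < n\<close> unfolding row[OF \<open>v < n\<close>] row_matrix_bits[OF \<open>v < n\<close>] vertex_cover_def by auto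
    moreover have "k' \<le> card (row g n v) + l" using H(1) v(1) row[OF \<open>v < n\<close>] by (auto simp: high_def)
    ultimately show ?thesis using that[of v] by simp
  qed
  have cov: "q div n \<in> Y \<or> q mod n \<in> Y" if "q < n * n" "g q" for q
  proof -
    have "0 < n" using that by (cases n) auto
    then have "q div n < n" "q mod n < n" using that by (simp_all add: less_mult_imp_div_less)
    then show ?thesis using that g[of q] Y(1) by (auto simp: vertex_cover_def matrix_bits_def)
  qed
  obtain A Z t where Z: "A \<subseteq> {..<t}" "\<And>b. (\<forall>i<t. b i = (i \<in> A)) \<Longrightarrow> cover_run g n b (row g n c) (n * n) = (Z, t)"
    "Z \<subseteq> Y" "card Z = card (row g n c) + t"
    using cover_run_complete[of "n * n" g n Y "row g n c"] cov c(2) fin by auto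
  have cZ: "card Z \<le> k'" using card_mono[OF fin Z(3)] Yk by simp
  \<comment> \<open>The starting row uses up all but \<open>l\<close> of the budget
    \<open>k'\<close>, and every branching costs one vertex.\<close>
  then have "t \<le> l" using Z(4) c(3) by simp
  then have "A \<subseteq> {..<l}" using Z(1) by auto
  then obtain m :: nat where m: "m < 2 ^ l" "\<And>i. bit m i = (i \<in> A)" using ex_bits by blast
  have "{x. x < n \<and> x \<in> Z} \<subseteq> Z" "finite Z" using Z(3) fin finite_subset by auto
  then have "card {x. x < n \<and> x \<in> Z} \<le> k'" using cZ card_mono by (meson order_trans)
  then have "success g n k' c m" using Z(2)[of "bit m"] m(2) by (simp add: success_def)
  then show "\<exists>c\<le>n. \<exists>m<2 ^ l. success g n k' c m" using c(1) m(1) by blast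
qed

definition vc_prog :: com where
  "vc_prog = read_n ;; read_matrix ;; read_k ;; threshold ;; search"

lemma matrix_word:
  "concat (map (\<lambda>i. map (\<lambda>j. f i j) [0..<n]) [0..<m]) = map (\<lambda>p. f (p div n) (p mod n)) [0..<m * n]"
proof (induction m)
  case (Suc m)
  have "map (\<lambda>p. f (p div n) (p mod n)) [m * n..<n + m * n] = map (\<lambda>j. f m j) [0..<n]"
    unfolding map_add_upt[symmetric] by (cases "n = 0") auto
  then show ?case using Suc upt_add_eq_append[of 0 "m * n" n] by (simp add: add.commute)
qed simp

text \<open>One summand for each of the five phases and 4 for the sequences between them. The
  argument \<open>l + 2\<close> of \<open>row_time\<close> reflects the overshoot of the threshold
  loop.\<close>

definition vc_time :: "nat \<Rightarrow> nat \<Rightarrow> nat \<Rightarrow> nat" where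
  "vc_time n b l = (2 * n + 1) + (6 * (n * n) + 5) + (b * (14 * n + 24) + 10) +
     ((n + 1) * (n * (9 * n + 21) + 2 * n + 2 * (n * n) + 24) + 4) +
     ((n + 1) * (row_time n (l + 2) + 4 * n + 9) + 2 * n + 10) + 4"

lemma row_time_mono: "l \<le> l' \<Longrightarrow> row_time n l \<le> row_time n l'"
  unfolding row_time_def by (intro add_mono mult_mono power_increasing) auto

text \<open>The parameter is formed with the capped \<open>k\<close>. It is thus at most
  \<open>n\<close>, which keeps the threshold loop polynomial, and at most the parameter of the
  statement.\<close>

lemma ok_vc_prog:
  "ok vc_prog (init_store (encode n E k)) (vc_time n (length (bin k)) (min n k - h_index n E))
    (\<lambda>s. num s rZ = 0 \<and> (0 < num s rR \<longleftrightarrow> (\<exists>X. vertex_cover n E X \<and> card X \<le> k)))"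
proof -
  let ?s0 = "init_store (encode n E k)"
  let ?bs = "map (\<lambda>p. if E (p div n) (p mod n) then B1 else B0) [0..<n * n]"
  let ?k = "min n k"
  let ?l0 = "min n k - h_index n E"
  let ?Q = "\<lambda>s. num s rZ = 0 \<and> (0 < num s rR \<longleftrightarrow> (\<exists>X. vertex_cover n E X \<and> card X \<le> k))"
  have inp: "inp ?s0 = replicate n B1 @ Sep # (?bs @ Sep # (bin k @ [Sep]))"
    by (simp add: init_store_def encode_def matrix_word)
  have zero: "num ?s0 x = 0" "arr ?s0 a = (\<lambda>_. False)" for x a by (simp_all add: init_store_def)
  note fr = frame_def read_n_def read_matrix_def read_k_def
  show ?thesis unfolding vc_prog_def vc_time_def
  proof (rule ok_Seq[OF ok_read_n[OF zero(1) inp order_refl], where U = "(6 * (n * n) + 5) + (b * (14 * n + 24) + 10) +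
     ((n + 1) * (n * (9 * n + 21) + 2 * n + 2 * (n * n) + 24) + 4) +
     ((n + 1) * (row_time n (?l0 + 2) + 4 * n + 9) + 2 * n + 10) + 3" for b])
    fix s1
    assume 1: "num s1 rN = n \<and> inp s1 = ?bs @ Sep # (bin k @ [Sep])" and f1: "frame read_n ?s0 s1"
    have z1: "x \<noteq> rN \<Longrightarrow> num s1 x = 0" "arr s1 a = (\<lambda>_. False)" for x a
      using f1 zero by (auto simp: fr)
    show "ok (read_matrix ;; read_k ;; threshold ;; search) s1 ((6 * (n * n) + 5) + (length (bin k) * (14 * n + 24) + 10) +
     ((n + 1) * (n * (9 * n + 21) + 2 * n + 2 * (n * n) + 24) + 4) +
     ((n + 1) * (row_time n (?l0 + 2) + 4 * n + 9) + 2 * n + 10) + 3) ?Q"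
    proof (rule ok_Seq[OF ok_read_matrix[OF _ _ conjunct2[OF 1] _ order_refl], where U = "(length (bin k) * (14 * n + 24) + 10) +
     ((n + 1) * (n * (9 * n + 21) + 2 * n + 2 * (n * n) + 24) + 4) +
     ((n + 1) * (row_time n (?l0 + 2) + 4 * n + 9) + 2 * n + 10) + 2"])
      fix s2
      assume 2: "num s2 rP = length ?bs \<and> inp s2 = bin k @ [Sep] \<and> arr s2 aG = (\<lambda>i. i < length ?bs \<and> ?bs ! i = B1)"
        and f2: "frame read_matrix s1 s2"
      have z2: "x \<notin> {rN, rP} \<Longrightarrow> num s2 x = 0" "a \<noteq> aG \<Longrightarrow> arr s2 a = (\<lambda>_. False)" "num s2 rN = n" for x a
        using f2 z1 1 by (auto simp: fr)
      have "arr s2 aG p = matrix_bits n E p" for p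
        using 2 by (auto simp: matrix_bits_def split: if_splits)
      then have G2: "arr s2 aG = matrix_bits n E" "num s2 rP = n * n"
        using 2 by auto
      show "ok (read_k ;; threshold ;; search) s2 ((length (bin k) * (14 * n + 24) + 10) +
     ((n + 1) * (n * (9 * n + 21) + 2 * n + 2 * (n * n) + 24) + 4) +
     ((n + 1) * (row_time n (?l0 + 2) + 4 * n + 9) + 2 * n + 10) + 2) ?Q"
      proof (rule ok_Seq[OF ok_read_k[OF _ _ conjunct1[OF conjunct2[OF 2]] set_bin order_refl], where U = "
     ((n + 1) * (n * (9 * n + 21) + 2 * n + 2 * (n * n) + 24) + 4) +
     ((n + 1) * (row_time n (?l0 + 2) + 4 * n + 9) + 2 * n + 10) + 1"])
        fix s3
        assume 3: "num s3 rK = min (num s2 rN) (bin_val (bin k))" and f3: "frame read_k s2 s3"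
        have z3: "x \<notin> {rN, rP, rU, rT, rK, rQ} \<Longrightarrow> num s3 x = 0" "a \<noteq> aG \<Longrightarrow> arr s3 a = (\<lambda>_. False)" "num s3 rN = n"
          "num s3 rP = n * n" "arr s3 aG = matrix_bits n E" for x a
          using f3 z2 G2 by (auto simp: fr)
        have K: "num s3 rK = ?k" using 3 z2 bin_val_bin by simp
        show "ok (threshold ;; search) s3 (
     ((n + 1) * (n * (9 * n + 21) + 2 * n + 2 * (n * n) + 24) + 4) +
     ((n + 1) * (row_time n (?l0 + 2) + 4 * n + 9) + 2 * n + 10) + 1) ?Q"
        proof (rule ok_Seq[OF ok_threshold[OF z3(3,4) _ _ _ _ _ order_refl, where ?l0.0 = ?l0], where U = "
          ((n + 1) * (row_time n (?l0 + 2) + 4 * n + 9) + 2 * n + 10)"])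
          fix s4
          assume 4: "1 \<le> num s4 rL \<and> num s4 rL \<le> ?l0 + 2 \<and>
            (\<forall>p<n * n. arr s4 aG p = arr s3 aG p) \<and>
            row (arr s4 aG) n n \<subseteq> high (arr s3 aG) n (num s3 rK) (num s4 rL) \<and>
            num s3 rK \<le> num s4 rL + card (row (arr s4 aG) n n)" and f4: "frame threshold s3 s4"
          have n4: "num s4 rN = n" "num s4 rK = ?k" "num s4 rO = 0" "num s4 rC = 0" "num s4 rR = 0" "num s4 rZ = 0"
            "arr s4 aB = (\<lambda>_. False)" using f4 z3 K by (auto simp: frame_def)
          have "(\<exists>X. vertex_cover n E X \<and> card X \<le> k) \<longleftrightarrow>
              (\<exists>c\<le>n. \<exists>m<2 ^ num s4 rL. success (arr s4 aG) n ?k c m)"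
            by (rule search_correct) (use 4 z3 K in auto)
          moreover have "ok search s4 ((n + 1) * (row_time n (num s4 rL) + 4 * n + 9) + 2 * n + 10)
            (\<lambda>s'. (0 < num s' rR \<longleftrightarrow> (\<exists>c\<le>n. \<exists>m<2 ^ num s4 rL. success (arr s4 aG) n (num s4 rK) c m)) \<and>
              frame search s4 s')"
            using 4 by (intro ok_frame ok_search[OF n4(1) refl _ n4(3,4,5,7) order_refl]) auto
          moreover have "(n + 1) * (row_time n (num s4 rL) + 4 * n + 9) \<le> (n + 1) * (row_time n (?l0 + 2) + 4 * n + 9)"
            using row_time_mono[of "num s4 rL" "?l0 + 2" n] 4 by (intro mult_le_mono2) simp
          moreover have "rZ \<notin> regs search" by (simp add: search_def)
          ultimately show "ok search s4 ((n + 1) * (row_time n (?l0 + 2) + 4 * n + 9) + 2 * n + 10) ?Q"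
            by (elim ok_mono) (use n4 in \<open>auto simp: frame_def\<close>)
        next
          show "num s3 rK \<le> ?l0 + card (high (arr s3 aG) n (num s3 rK) ?l0)"
            unfolding K z3(5) by (rule high_h_index)
        qed (use z3 row_matrix_bits_last in auto)
      qed (use z2 in auto)
    qed (use z1 in auto)
  qed simp
qed

section \<open>The running time\<close>

text \<open>The search dominates: \<open>n + 1\<close> rows with a constant times
  \<open>2 ^ l\<close> trials of quadratic cost. All other terms are polynomial of degree at most 3,
  where \<open>l \<le> n\<close> takes care of the time for counting; 1000 is a generous round
  constant.\<close>

lemma vc_time_bound:
  assumes n: "n + 1 \<le> N" and b: "b \<le> N" and l: "l \<le> n"
  shows "vc_time n b l + 1 \<le> 1000 * (2 ^ l * N ^ 3)"
proof -
  define e :: nat where "e = 2 ^ l"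
  define S where "S = N * N"
  define C where "C = N * S"
  define u where "u = e * C"
  have e: "1 \<le> e" by (simp add: e_def)
  have N: "1 \<le> N" "n \<le> N" "l + 2 \<le> 3 * N" using assms by auto
  have S: "n * n \<le> S" "1 \<le> S" "N \<le> S" using N unfolding S_def by (auto intro: mult_le_mono)
  have C: "S \<le> C" "C \<le> u" using N(1) e by (auto simp: C_def u_def)
  have sq: "n * (9 * n + 21) = 9 * (n * n) + 21 * n" by (simp add: algebra_simps)
  have "n * (9 * n + 21) + 2 * n + 2 * (n * n) + 24 \<le> 58 * S"
    unfolding sq using S N by linarith
  from mult_le_mono[OF n this]
  have 1: "(n + 1) * (n * (9 * n + 21) + 2 * n + 2 * (n * n) + 24) \<le> 58 * C"
    by (simp add: C_def)
  have "14 * n + 24 \<le> 38 * N" using N by linarith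
  from mult_le_mono[OF b this] have 2: "b * (14 * n + 24) \<le> 38 * S" by (simp add: S_def)
  have "4 * (l + 2) \<le> 12 * N" using N(3) by simp
  then have "15 * (n * n) + 19 * n + 4 * (l + 2) + 36 \<le> 82 * S"
    using S N(1,2) by linarith
  \<comment> \<open>The factor 4 comes from \<open>2 ^ (l + 2)\<close>.\<close>
  then have "4 * e * (15 * (n * n) + 19 * n + 4 * (l + 2) + 36) \<le> 4 * e * (82 * S)"
    by (rule mult_le_mono2)
  then have "row_time n (l + 2) \<le> 328 * (e * S) + 6"
    by (simp add: row_time_def e_def ac_simps)
  moreover have "S \<le> e * S" using e by simp
  ultimately have "row_time n (l + 2) + 4 * n + 9 \<le> 347 * (e * S)"
    using S N by linarith
  from mult_le_mono[OF n this]
  have 3: "(n + 1) * (row_time n (l + 2) + 4 * n + 9) \<le> 347 * u"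
    by (simp add: u_def C_def ac_simps)
  have "vc_time n b l + 1 \<le> 1000 * u"
    unfolding vc_time_def using 1 2 3 S N C by linarith
  then show ?thesis by (simp add: u_def C_def S_def e_def power3_eq_cube)
qed

section \<open>A computable function dominating the powers of four\<close>

text \<open>Every input symbol adds \<open>3 * rR\<close> to \<open>rR\<close>. The final value is
  positive, so the machine ends in state 1, as \<open>computable\<close> demands.\<close>

definition pow_prog :: com where
  "pow_prog = Do (Inc rR) ;; While (Get True Sep) (copy rT rR ;; Do (Zero rU) ;;
     While (Lt rU rT) (Do (Inc rU) ;; Do (Inc rR) ;; Do (Inc rR) ;; Do (Inc rR)))"

lemma ok_pow_prog:
  "\<exists>T. ok pow_prog (init_store (replicate n B1)) T (\<lambda>s. num s rR = 4 ^ n \<and> num s rZ = 0)"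
proof -
  let ?s = "peff (Inc rR) (init_store (replicate n B1))"
  let ?add = "While (Lt rU rT) (Do (Inc rU) ;; Do (Inc rR) ;; Do (Inc rR) ;; Do (Inc rR))"
  let ?T = "10 * 4 ^ n + 10"
  have "ok (While (Get True Sep) (copy rT rR ;; Do (Zero rU) ;; ?add)) ?s (n * (?T + 1) + 1)
    (\<lambda>s. num s rR = 4 ^ n \<and> num s rZ = 0)"
  proof (rule ok_for[where I = "\<lambda>i s. num s rR = 4 ^ i \<and> inp s = replicate (n - i) B1 @ [Sep]" and n = n and T = ?T], goal_cases)
    case (2 i s)
    let ?s1 = "peff (Get True Sep) s"
    have le: "(4::nat) ^ i \<le> 4 ^ n" using 2(1) by (intro power_increasing) auto
    have R: "num s rR = 4 ^ i" using 2(2) by simp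
    have inp: "inp s = B1 # replicate (n - Suc i) B1 @ [Sep]" using 2 by (simp add: Suc_diff_Suc[symmetric])
    have "ok (copy rT rR ;; Do (Zero rU) ;; ?add) ?s1 ?T
      (\<lambda>s. num s rR = 4 ^ Suc i \<and> inp s = replicate (n - Suc i) B1 @ [Sep])"
    proof (rule ok_Seq[OF ok_copy[OF _ order_refl], where U = "8 * 4 ^ i + 3"], goal_cases)
      case (2 s2)
      have "ok ?add (peff (Zero rU) s2) (4 ^ i * (7 + 1) + 1)
        (\<lambda>s. num s rR = 4 ^ Suc i \<and> inp s = replicate (n - Suc i) B1 @ [Sep])"
        by (rule ok_for[where I = "\<lambda>j s. num s rU = j \<and> num s rR = 4 ^ i + 3 * j" and n = "4 ^ i" and T = 7])
          (use 2 R inp in \<open>auto simp: frame_def\<close>)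
      then show ?case by (simp add: ac_simps)
    next
      case 3
      show ?case using le R by (simp del: power_increasing_iff)
    qed simp
    then show ?case using inp by simp
  qed (auto simp: init_store_def frame_def)
  then have "ok pow_prog (init_store (replicate n B1)) (n * (?T + 1) + 3) (\<lambda>s. num s rR = 4 ^ n \<and> num s rZ = 0)"
    by (simp add: pow_prog_def)
  then show ?thesis by blast
qed

text \<open>Cells outside the two lists are blank, so different ones on the tape are different
  entries of the lists.\<close>

lemma count_on_tape:
  assumes tp: "on_tape p T l r" and S: "\<And>z. z \<in> S \<Longrightarrow> T z = B1"
  shows "card S \<le> length (filter (\<lambda>x. x = B1) (l @ r))"
proof -
  let ?R = "{i. i < length r \<and> r ! i = B1}" let ?L = "{i. i < length l \<and> l ! i = B1}"
  have "z \<in> (\<lambda>i. p + int i) ` ?R \<union> (\<lambda>i. p - 1 - int i) ` ?L" if "z \<in> S" for z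
  proof (cases "p \<le> z")
    case True
    then have z: "z = p + int (nat (z - p))" by simp
    then have "nth_default Bl r (nat (z - p)) = B1" using tp S[OF that] unfolding on_tape_def by metis
    then have "nat (z - p) \<in> ?R" by (auto simp: nth_default_def split: if_splits)
    then show ?thesis using z by blast
  next
    case False
    then have z: "z = p - 1 - int (nat (p - 1 - z))" by simp
    then have "nth_default Bl l (nat (p - 1 - z)) = B1" using tp S[OF that] unfolding on_tape_def by metis
    then have "nat (p - 1 - z) \<in> ?L" by (auto simp: nth_default_def split: if_splits)
    then show ?thesis using z by blast
  qed
  then have "card S \<le> card ((\<lambda>i. p + int i) ` ?R \<union> (\<lambda>i. p - 1 - int i) ` ?L)"
    by (intro card_mono) auto
  also have "\<dots> \<le> card ?R + card ?L"
    by (intro order_trans[OF card_Un_le] add_mono card_image_le) auto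
  finally show ?thesis by (simp add: length_filter_conv_card)
qed

lemma computable_dominating: "\<exists>f. computable f \<and> (\<forall>n. 4 ^ n \<le> f n)"
proof -
  obtain M where M: "wf_tm M" "\<And>w t s u. Bl \<notin> set w \<Longrightarrow> exec pow_prog (init_store w) t s \<Longrightarrow>
     2 * (2 * length w + 4 + prim_cost * (t + 1) * (t + 1)) \<le> u \<Longrightarrow>
     \<exists>l r q. run M u w = (if num s rZ < num s rR then 1 else 2, l, r) \<and> on_tape (-1) (htape s q) l r"
    using compile_to_tm[of pow_prog] by blast
  have "\<exists>a. (\<exists>t. case run M t (replicate n B1) of (q, l, r) \<Rightarrow>
      q = 1 \<and> length (filter (\<lambda>x. x = B1) (l @ r)) = a) \<and> 4 ^ n \<le> a" for n
  proof -
    obtain t s where s: "exec pow_prog (init_store (replicate n B1)) t s" "num s rR = 4 ^ n" "num s rZ = 0"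
      using ok_pow_prog[of n] unfolding ok_def by blast
    obtain u l r q where u: "run M u (replicate n B1) = (1, l, r)" "on_tape (-1) (htape s q) l r"
      using M(2)[OF _ s(1) order_refl] s by fastforce
    \<comment> \<open>The cells of \<open>rR\<close> alone account for \<open>4 ^ n\<close> ones, by
      the unary representation; ones elsewhere can only increase the count.\<close>
    let ?S = "(\<lambda>i. tpos i (idx (Num rR))) ` {..<4 ^ n}"
    have "0 < width" using idx_less[of "Num rR"] by simp
    then have "inj_on (\<lambda>i. tpos i (idx (Num rR))) {..<4 ^ n}" by (auto simp: inj_on_def tpos_def)
    then have "card ?S = 4 ^ n" by (simp add: card_image)
    moreover have "htape s q z = B1" if "z \<in> ?S" for z
      using that s(2) by (auto simp: htape_def tbits_def)
    ultimately have "4 ^ n \<le> length (filter (\<lambda>x. x = B1) (l @ r))"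
      using count_on_tape[OF u(2), of ?S] by simp
    then show ?thesis using u(1) by (intro exI[of _ "length (filter (\<lambda>x. x = B1) (l @ r))"]) (auto intro!: exI[of _ u])
  qed
  then obtain f where "\<And>n. (\<exists>t. case run M t (replicate n B1) of (q, l, r) \<Rightarrow>
      q = 1 \<and> length (filter (\<lambda>x. x = B1) (l @ r)) = f n) \<and> 4 ^ n \<le> f n" by metis
  then show ?thesis using M(1) unfolding computable_def by blast
qed

section \<open>Comparison with the required time bound\<close>

lemma encode_no_blank: "Bl \<notin> set (encode n E k)"
  using set_bin[of k] by (auto simp: encode_def )

lemma length_encode: "length (encode n E k) = n + n * n + length (bin k) + 2"
  by (simp add: encode_def matrix_word)

text \<open>Moves the constant factor of the simulation into the exponent of the input
  length.\<close>

lemma const_le_power: "2 \<le> N \<Longrightarrow> d \<le> N ^ d" for N d :: nat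
  by (meson less_exp less_imp_le order_trans power_mono zero_le)

theorem theorem1:
  shows "\<exists>f M c. computable f \<and> wf_tm M \<and>
    (\<forall>n E k. is_graph n E \<longrightarrow>
       (let I = encode n E k;
            ell = nat (int k - int (h_index n E));
            T = f ell * length I ^ c
        in if (\<exists>X. vertex_cover n E X \<and> card X \<le> k)
           then accepts_within M I T
           else rejects_within M I T))"
proof -
  obtain f where f: "computable f" "\<And>n. 4 ^ n \<le> f n" using computable_dominating by blast
  obtain M where M: "wf_tm M" "\<And>w t s u. Bl \<notin> set w \<Longrightarrow> exec vc_prog (init_store w) t s \<Longrightarrow>
     2 * (2 * length w + 4 + prim_cost * (t + 1) * (t + 1)) \<le> u \<Longrightarrow>
     \<exists>l r q. run M u w = (if num s rZ < num s rR then 1 else 2, l, r) \<and> on_tape (-1) (htape s q) l r"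
    using compile_to_tm[of vc_prog] by blast
  \<comment> \<open>Twice \<open>6 + 1000000 * prim_cost\<close>: the factor 2 stems from stay
    moves, 6 covers the initial scan, and \<open>1000000\<close> is the square of the constant of
    \<open>vc_time_bound\<close>. In the exponent \<open>d + 6\<close>, the 6 comes from squaring
    \<open>N ^ 3\<close>.\<close>
  define d where "d = 12 + 2000000 * prim_cost"
  have "if (\<exists>X. vertex_cover n E X \<and> card X \<le> k)
       then accepts_within M (encode n E k) (f (nat (int k - int (h_index n E))) * length (encode n E k) ^ (d + 6))
       else rejects_within M (encode n E k) (f (nat (int k - int (h_index n E))) * length (encode n E k) ^ (d + 6))"
    for n E k
  proof -
    let ?w = "encode n E k"
    define yes where "yes \<longleftrightarrow> (\<exists>X. vertex_cover n E X \<and> card X \<le> k)"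
    define N where "N = length ?w"
    define l where "l = min n k - h_index n E"
    define ell where "ell = nat (int k - int (h_index n E))"
    have l: "l \<le> ell" "l \<le> n" by (auto simp: l_def ell_def)
    have N: "n + 1 \<le> N" "length (bin k) \<le> N" "2 \<le> N" by (auto simp: N_def length_encode )
    obtain t s where t: "exec vc_prog (init_store ?w) t s" "t \<le> vc_time n (length (bin k)) l"
      "num s rZ = 0" "0 < num s rR \<longleftrightarrow> yes"
      using ok_vc_prog[of n E k] unfolding ok_def l_def yes_def[symmetric] by blast
    define u where "u = 2 ^ l * N ^ 3"
    have tu: "t + 1 \<le> 1000 * u" using t(2) vc_time_bound[OF N(1,2) l(2)] by (simp add: u_def)
    have "(4::nat) ^ l = 2 ^ l * 2 ^ l" "N ^ 6 = N ^ 3 * N ^ 3"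
      by (simp flip: power_mult_distrib) (simp flip: power_add)
    then have uu: "u * u = 4 ^ l * N ^ 6" by (simp add: u_def)
    define x where "x = u * u"
    have "prim_cost * (t + 1) * (t + 1) \<le> prim_cost * (1000 * u) * (1000 * u)"
      using tu by (intro mult_le_mono) auto
    also have "\<dots> = 1000000 * (prim_cost * x)" by (simp add: x_def)
    finally have cost: "prim_cost * (t + 1) * (t + 1) \<le> 1000000 * (prim_cost * x)" .
    have "N ^ 1 \<le> N ^ 6" using N by (intro power_increasing) auto
    also have "\<dots> \<le> x" unfolding x_def uu by simp
    finally have "N \<le> x" by simp
    then have "2 * N + 4 + prim_cost * (t + 1) * (t + 1) \<le> 6 * x + 1000000 * (prim_cost * x)"
      using cost N(3) by linarith
    then have "2 * (2 * N + 4 + prim_cost * (t + 1) * (t + 1)) \<le> 2 * (6 * x + 1000000 * (prim_cost * x))"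
      by (rule mult_le_mono2)
    also have "\<dots> = d * (u * u)" by (simp add: d_def x_def distrib_right)
    also have "\<dots> \<le> N ^ d * (u * u)" using const_le_power[OF N(3)] by (rule mult_le_mono1)
    also have "\<dots> = 4 ^ l * N ^ (d + 6)" unfolding uu power_add by simp
    also have "\<dots> \<le> f ell * N ^ (d + 6)"
    proof (rule mult_le_mono1)
      have "(4::nat) ^ l \<le> 4 ^ ell" using l(1) by (intro power_increasing) auto
      then show "4 ^ l \<le> f ell" using f(2)[of ell] by (rule order_trans)
    qed
    finally obtain a r where "run M (f ell * N ^ (d + 6)) ?w = (if num s rZ < num s rR then 1 else 2, a, r)"
      using M(2)[OF encode_no_blank t(1)] unfolding N_def by blast
    then show ?thesis unfolding ell_def[symmetric] N_def[symmetric] yes_def[symmetric] using t(3,4)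
      by (simp add: accepts_within_def rejects_within_def state_of_def)
  qed
  then show ?thesis using f(1) M(1) unfolding Let_def by blast
qed

end
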